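(* Let $\mathcal{F}=\{f_i\}_{i\in I}$ be a $J$-frame for a Krein space $\mathcal{H}$ with $J$-frame operator $S$, and let $S^{1/2}$ be the self-adjoint square root of $S$ defined by $$S^{1/2}=\frac{1}{2\pi i}\int_\Gamma z^{1/2}(z-S)^{-1}\,dz .$$ Then, with $S^{-1/2}=(S^{1/2})^{-1}$, the family $\mathcal{P}=\{S^{-1/2}f_i\}_{i\in I}$ is a Parseval $J$-frame for $\mathcal{H}$ which is similar to $\mathcal{F}$.
   Context: A (complex) Krein space is a vector space $\mathcal{H}$ with a hermitian sesquilinear form $[\cdot,\cdot]$ admitting a fundamental decomposition $\mathcal{H}=\mathcal{H}_+\dotplus\mathcal{H}_-$, direct and $[\cdot,\cdot]$-orthogonal, with $(\mathcal{H}_+,[\cdot,\cdot])$ and $(\mathcal{H}_-,-[\cdot,\cdot])$ Hilbert spaces. Fix one; the associated Hilbert inner product is $\langle x,y\rangle=[x_+,y_+]-[x_-,y_-]$, with norm $\|\cdot\|$ (the topology does not depend on the decomposition). A subspace $\mathcal{S}$ is uniformly $J$-positive (resp. uniformly $J$-negative) if there is $\alpha>0$ with $[x,x]\ge\alpha\|x\|^2$ (resp. $-[x,x]\ge\alpha\|x\|^2$) for all $x\in\mathcal{S}$; it is maximal if it is maximal under inclusion among such subspaces. The adjoint $T^+$ of a bounded operator between Krein spaces is defined by $[Tx,y]=[x,T^+y]$. A Bessel family is $\mathcal{F}=\{f_i\}_{i\in I}\subset\mathcal{H}$ with $\sum_i|\langle f,f_i\rangle|^2\le\beta\|f\|^2$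 for all $f\in\mathcal{H}$ and some $\beta>0$; its synthesis operator is the bounded operator $T:\ell_2(I)\to\mathcal{H}$, $Tx=\sum_{i\in I}x_if_i$. Put $I_+=\{i: [f_i,f_i]\ge0\}$, $I_-=\{i:[f_i,f_i]<0\}$ (sets depending on the family); $P_\pm$ is the orthogonal projection of $\ell_2(I)$ onto $\ell_2(I_\pm)$ and $T_\pm=TP_\pm$. The Bessel family $\mathcal{F}$ is a $J$-frame for $\mathcal{H}$ if the range $R(T_+)$ is a maximal uniformly $J$-positive subspace and $R(T_-)$ is a maximal uniformly $J$-negative subspace of $\mathcal{H}$. Given a $J$-frame, $\ell_2(I)$ is the Krein space with $[x,y]_2=\sum_{i\in I_+}x_i\overline{y_i}-\sum_{i\in I_-}x_i\overline{y_i}$, $T^+$ is taken with respect to this form, and the $J$-frame operator is $S=TT^+$, an invertible operator with $S=S^+$. A $J$-frame is a Parseval $J$-frame if its $J$-frame operator is $I$. Two frames $\{f_i\}_{i\in I}$, $\{g_i\}_{i\in I}$ for $\mathcal{H}$ are similar if there is an invertible $V\in L(\mathcal{H})$ with $Vf_i=g_i$ for all $i\in I$. Known fact used to define $S^{1/2}$: the spectrum $\sigma(S)$ of a $J$-frame operator lies in the open right half-plane. $\Gamma$ is a Jordan curve enclosing $\sigma(S)$ and contained in the open right half-plane, and $z^{1/2}$ is the principal branch. $S^{1/2}$ is invertible, satisfies $(S^{1/2})^2=S$ and $(S^{1/2})^+=S^{1/2}$, and is the unique bounded $P$ with $P^2=S$ and $\sigma(P)\subseteq\{re^{it}:r>0,\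 t\in(-\pi/4,\pi/4)\}$. *)

theory Defs
  imports "HOL-Complex_Analysis.Complex_Analysis"
begin

section \<open>Krein spaces\<close>

class complex_vector = real_vector +
  fixes scaleC :: "complex \<Rightarrow> 'a \<Rightarrow> 'a" (infixr "*\<^sub>C" 75)
  assumes scaleC_add_right: "c *\<^sub>C (x + y) = c *\<^sub>C x + c *\<^sub>C y"
    and scaleC_add_left: "(c + d) *\<^sub>C x = c *\<^sub>C x + d *\<^sub>C x"
    and scaleC_scaleC: "c *\<^sub>C d *\<^sub>C x = (c * d) *\<^sub>C x"
    and scaleR_scaleC: "r *\<^sub>R x = complex_of_real r *\<^sub>C x"

global_interpretation cvec: vector_space "scaleC :: complex \<Rightarrow> 'a \<Rightarrow> 'a::complex_vector"
proof
  fix x :: 'a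
  show "1 *\<^sub>C x = x"
    using scaleR_scaleC [of 1 x] by simp
qed (simp_all add: scaleC_add_right scaleC_add_left scaleC_scaleC)

text \<open>
  The class \<open>krein_space\<close> carries one fixed fundamental decomposition, and the norm of the type (hence its
  topology) is the Hilbert norm belonging to that decomposition. The form is linear in its first
  argument. By hermitian symmetry \<open>kform x x\<close> is real, so that \<open>Re (kform x x)\<close> is \<open>[x, x]\<close>.
  The axioms on \<open>Hplus\<close> and \<open>Hminus\<close> spell out \<^const>\<open>module.subspace\<close> and
  \<^const>\<open>complete\<close>, which the class specification mechanism does not accept here; the lemmas
  below recover them.
\<close>

class krein_space = complex_vector + real_normed_vector +
  fixes kform :: "'a \<Rightarrow> 'a \<Rightarrow> complex"
    and Hplus :: "'a set"
    and Hminus :: "'a set"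
  assumes kform_add_left: "kform (x + y) z = kform x z + kform y z"
    and kform_scaleC_left: "kform (c *\<^sub>C x) y = c * kform x y"
    and kform_hermitian: "kform y x = cnj (kform x y)"
    and Hplus_0: "0 \<in> Hplus"
    and Hplus_add: "x \<in> Hplus \<Longrightarrow> y \<in> Hplus \<Longrightarrow> x + y \<in> Hplus"
    and Hplus_scaleC: "x \<in> Hplus \<Longrightarrow> c *\<^sub>C x \<in> Hplus"
    and Hminus_0: "0 \<in> Hminus"
    and Hminus_add: "x \<in> Hminus \<Longrightarrow> y \<in> Hminus \<Longrightarrow> x + y \<in> Hminus"
    and Hminus_scaleC: "x \<in> Hminus \<Longrightarrow> c *\<^sub>C x \<in> Hminus"
    and Hplus_Hminus_span: "\<exists>p\<in>Hplus. \<exists>m\<in>Hminus. x = p + m"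
    and Hplus_Hminus_direct: "Hplus \<inter> Hminus = {0}"
    and Hplus_Hminus_orthogonal: "p \<in> Hplus \<Longrightarrow> m \<in> Hminus \<Longrightarrow> kform p m = 0"
    and Hplus_pos_def: "p \<in> Hplus \<Longrightarrow> p \<noteq> 0 \<Longrightarrow> Re (kform p p) > 0"
    and Hminus_neg_def: "m \<in> Hminus \<Longrightarrow> m \<noteq> 0 \<Longrightarrow> Re (kform m m) < 0"
    and norm_decomposition: "p \<in> Hplus \<Longrightarrow> m \<in> Hminus \<Longrightarrow>
          norm (p + m) = sqrt (Re (kform p p) - Re (kform m m))"
    and Cauchy_convergent_Hplus:
          "(\<And>n::nat. X n \<in> Hplus) \<Longrightarrow>
          \<forall>e>0. \<exists>N. \<forall>m\<ge>N. \<forall>n\<ge>N. norm (X m - X n) < e \<Longrightarrow>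
          \<exists>l\<in>Hplus. \<forall>e>0. \<exists>N. \<forall>n\<ge>N. norm (X n - l) < e"
    and Cauchy_convergent_Hminus:
          "(\<And>n::nat. X n \<in> Hminus) \<Longrightarrow>
          \<forall>e>0. \<exists>N. \<forall>m\<ge>N. \<forall>n\<ge>N. norm (X m - X n) < e \<Longrightarrow>
          \<exists>l\<in>Hminus. \<forall>e>0. \<exists>N. \<forall>n\<ge>N. norm (X n - l) < e"

lemma complete_Hplus: "complete (Hplus :: 'a::krein_space set)"
proof (rule completeI)
  fix X :: "nat \<Rightarrow> 'a" assume "\<forall>n. X n \<in> Hplus" "Cauchy X"
  then show "\<exists>l\<in>Hplus. X \<longlonglongrightarrow> l"
    using Cauchy_convergent_Hplus [of X] by (simp add: Cauchy_iff LIMSEQ_iff)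
qed

lemma complete_Hminus: "complete (Hminus :: 'a::krein_space set)"
proof (rule completeI)
  fix X :: "nat \<Rightarrow> 'a" assume "\<forall>n. X n \<in> Hminus" "Cauchy X"
  then show "\<exists>l\<in>Hminus. X \<longlonglongrightarrow> l"
    using Cauchy_convergent_Hminus [of X] by (simp add: Cauchy_iff LIMSEQ_iff)
qed

lemma cvec_subspace_Hplus: "cvec.subspace (Hplus :: 'a::krein_space set)"
  by (rule cvec.subspaceI) (simp_all add: Hplus_0 Hplus_add Hplus_scaleC)

lemma cvec_subspace_Hminus: "cvec.subspace (Hminus :: 'a::krein_space set)"
  by (rule cvec.subspaceI) (simp_all add: Hminus_0 Hminus_add Hminus_scaleC)

definition plus_part :: "'a::krein_space \<Rightarrow> 'a" where
  "plus_part x = (THE p. p \<in> Hplus \<and> x - p \<in> Hminus)"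

definition minus_part :: "'a::krein_space \<Rightarrow> 'a" where
  "minus_part x = x - plus_part x"

definition hinner :: "'a::krein_space \<Rightarrow> 'a \<Rightarrow> complex" where
  "hinner x y = kform (plus_part x) (plus_part y) - kform (minus_part x) (minus_part y)"

definition uniformly_J_positive :: "'a::krein_space set \<Rightarrow> bool" where
  "uniformly_J_positive M \<longleftrightarrow>
     cvec.subspace M \<and> (\<exists>\<alpha>>0. \<forall>x\<in>M. Re (kform x x) \<ge> \<alpha> * (norm x)\<^sup>2)"

definition uniformly_J_negative :: "'a::krein_space set \<Rightarrow> bool" where
  "uniformly_J_negative M \<longleftrightarrow>
     cvec.subspace M \<and> (\<exists>\<alpha>>0. \<forall>x\<in>M. - Re (kform x x) \<ge> \<alpha> * (norm x)\<^sup>2)"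

definition maximal_uniformly_J_positive :: "'a::krein_space set \<Rightarrow> bool" where
  "maximal_uniformly_J_positive M \<longleftrightarrow>
     uniformly_J_positive M \<and> (\<forall>N. uniformly_J_positive N \<and> M \<subseteq> N \<longrightarrow> N = M)"

definition maximal_uniformly_J_negative :: "'a::krein_space set \<Rightarrow> bool" where
  "maximal_uniformly_J_negative M \<longleftrightarrow>
     uniformly_J_negative M \<and> (\<forall>N. uniformly_J_negative N \<and> M \<subseteq> N \<longrightarrow> N = M)"

section \<open>Bounded operators and the operator square root\<close>

definition bounded_clinear :: "('a::krein_space \<Rightarrow> 'a) \<Rightarrow> bool" where
  "bounded_clinear A \<longleftrightarrow> bounded_linear A \<and> (\<forall>c x. A (c *\<^sub>C x) = c *\<^sub>C A x)"

definition invertible_op :: "('a::krein_space \<Rightarrow> 'a) \<Rightarrow> bool" where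
  "invertible_op A \<longleftrightarrow>
     bounded_clinear A \<and> (\<exists>B. bounded_clinear B \<and> A \<circ> B = id \<and> B \<circ> A = id)"

definition op_spectrum :: "('a::krein_space \<Rightarrow> 'a) \<Rightarrow> complex set" where
  "op_spectrum A = {z. \<not> invertible_op (\<lambda>x. z *\<^sub>C x - A x)}"

definition resolvent :: "('a::krein_space \<Rightarrow> 'a) \<Rightarrow> complex \<Rightarrow> 'a \<Rightarrow> 'a" where
  "resolvent A z = inv (\<lambda>x. z *\<^sub>C x - A x)"

text \<open>
  The contour integral of an operator-valued function is taken in the normed space of bounded
  operators, with the same parametrisation convention as \<^const>\<open>contour_integral\<close>. The type
  \<open>'a \<Rightarrow>\<^sub>L 'a\<close> consists of the bounded real-linear operators; it contains the bounded
  complex-linear ones as a closed subspace, with the same norm.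
\<close>

definition op_contour_integral ::
    "(real \<Rightarrow> complex) \<Rightarrow> (complex \<Rightarrow> 'a::krein_space \<Rightarrow> 'a) \<Rightarrow> 'a \<Rightarrow>\<^sub>L 'a" where
  "op_contour_integral \<gamma> F =
     integral {0..1}
       (\<lambda>t. Blinfun (\<lambda>x. vector_derivative \<gamma> (at t within {0..1}) *\<^sub>C F (\<gamma> t) x))"

text \<open>\<^const>\<open>csqrt\<close> is the principal branch of the square root.\<close>

definition contour_sqrt :: "(real \<Rightarrow> complex) \<Rightarrow> ('a::krein_space \<Rightarrow> 'a) \<Rightarrow> 'a \<Rightarrow> 'a" where
  "contour_sqrt \<gamma> A x =
     (1 / (2 * of_real pi * \<i>)) *\<^sub>C
       blinfun_apply (op_contour_integral \<gamma> (\<lambda>z x. csqrt z *\<^sub>C resolvent A z x)) x"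

section \<open>Frames and J-frames\<close>

definition bessel_family :: "'i set \<Rightarrow> ('i \<Rightarrow> 'a::krein_space) \<Rightarrow> bool" where
  "bessel_family I f \<longleftrightarrow>
     (\<exists>\<beta>>0. \<forall>h. (\<lambda>i. (cmod (hinner h (f i)))\<^sup>2) summable_on I \<and>
        (\<Sum>\<^sub>\<infinity>i\<in>I. (cmod (hinner h (f i)))\<^sup>2) \<le> \<beta> * (norm h)\<^sup>2)"

definition frame :: "'i set \<Rightarrow> ('i \<Rightarrow> 'a::krein_space) \<Rightarrow> bool" where
  "frame I f \<longleftrightarrow> bessel_family I f \<and>
     (\<exists>\<alpha>>0. \<forall>h. \<alpha> * (norm h)\<^sup>2 \<le> (\<Sum>\<^sub>\<infinity>i\<in>I. (cmod (hinner h (f i)))\<^sup>2))"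

definition similar_frames ::
    "'i set \<Rightarrow> ('i \<Rightarrow> 'a::krein_space) \<Rightarrow> ('i \<Rightarrow> 'a) \<Rightarrow> bool" where
  "similar_frames I f g \<longleftrightarrow>
     frame I f \<and> frame I g \<and> (\<exists>V. invertible_op V \<and> (\<forall>i\<in>I. V (f i) = g i))"

text \<open>Elements of \<open>\<ell>\<^sub>2(I)\<close> are represented by their extension by zero to the whole index type.\<close>

definition ell2 :: "'i set \<Rightarrow> ('i \<Rightarrow> complex) set" where
  "ell2 I = {x. (\<forall>i. i \<notin> I \<longrightarrow> x i = 0) \<and> (\<lambda>i. (cmod (x i))\<^sup>2) summable_on I}"

definition synthesis :: "'i set \<Rightarrow> ('i \<Rightarrow> 'a::krein_space) \<Rightarrow> ('i \<Rightarrow> complex) \<Rightarrow> 'a" where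
  "synthesis I f x = (\<Sum>\<^sub>\<infinity>i\<in>I. x i *\<^sub>C f i)"

definition index_plus :: "'i set \<Rightarrow> ('i \<Rightarrow> 'a::krein_space) \<Rightarrow> 'i set" where
  "index_plus I f = {i\<in>I. Re (kform (f i) (f i)) \<ge> 0}"

definition index_minus :: "'i set \<Rightarrow> ('i \<Rightarrow> 'a::krein_space) \<Rightarrow> 'i set" where
  "index_minus I f = {i\<in>I. Re (kform (f i) (f i)) < 0}"

definition coord_proj :: "'i set \<Rightarrow> ('i \<Rightarrow> complex) \<Rightarrow> 'i \<Rightarrow> complex" where
  "coord_proj K x = (\<lambda>i. if i \<in> K then x i else 0)"

definition synthesis_plus :: "'i set \<Rightarrow> ('i \<Rightarrow> 'a::krein_space) \<Rightarrow> ('i \<Rightarrow> complex) \<Rightarrow> 'a" where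
  "synthesis_plus I f = synthesis I f \<circ> coord_proj (index_plus I f)"

definition synthesis_minus :: "'i set \<Rightarrow> ('i \<Rightarrow> 'a::krein_space) \<Rightarrow> ('i \<Rightarrow> complex) \<Rightarrow> 'a" where
  "synthesis_minus I f = synthesis I f \<circ> coord_proj (index_minus I f)"

definition J_frame :: "'i set \<Rightarrow> ('i \<Rightarrow> 'a::krein_space) \<Rightarrow> bool" where
  "J_frame I f \<longleftrightarrow>
     bessel_family I f \<and>
     maximal_uniformly_J_positive (synthesis_plus I f ` ell2 I) \<and>
     maximal_uniformly_J_negative (synthesis_minus I f ` ell2 I)"

definition ell2_form ::
    "'i set \<Rightarrow> ('i \<Rightarrow> 'a::krein_space) \<Rightarrow> ('i \<Rightarrow> complex) \<Rightarrow> ('i \<Rightarrow> complex) \<Rightarrow> complex" where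
  "ell2_form I f x y =
     (\<Sum>\<^sub>\<infinity>i\<in>index_plus I f. x i * cnj (y i)) - (\<Sum>\<^sub>\<infinity>i\<in>index_minus I f. x i * cnj (y i))"

text \<open>
  The adjoint of an operator \<open>T\<close> from a Krein space with carrier \<open>D\<close> and form \<open>q\<close> to the
  Krein space \<open>'a\<close>.
\<close>

definition krein_adjoint ::
    "'b set \<Rightarrow> ('b \<Rightarrow> 'b \<Rightarrow> complex) \<Rightarrow> ('b \<Rightarrow> 'a::krein_space) \<Rightarrow> 'a \<Rightarrow> 'b" where
  "krein_adjoint D q T y = (THE w. w \<in> D \<and> (\<forall>x\<in>D. kform (T x) y = q x w))"

definition J_frame_operator :: "'i set \<Rightarrow> ('i \<Rightarrow> 'a::krein_space) \<Rightarrow> 'a \<Rightarrow> 'a" where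
  "J_frame_operator I f =
     synthesis I f \<circ> krein_adjoint (ell2 I) (ell2_form I f) (synthesis I f)"

definition parseval_J_frame :: "'i set \<Rightarrow> ('i \<Rightarrow> 'a::krein_space) \<Rightarrow> bool" where
  "parseval_J_frame I f \<longleftrightarrow> J_frame I f \<and> J_frame_operator I f = id"

end

theory Submission
  imports Defs
begin

text \<open>
  Write \<open>[x, y]\<close> for the Krein form, \<open>S\<close> for the J-frame operator, \<open>Q = S\<^bsup>1/2\<^esup>\<close> for the
  contour integral and \<open>V = Q\<^sup>-\<^sup>1\<close>. The theorem rests on two facts: \<open>Q\<close> is a selfadjoint square
  root of the invertible operator \<open>S\<close>, and every selfadjoint \<open>V\<close> with \<open>V\<^sup>2 = S\<^sup>-\<^sup>1\<close> carries the
  J-frame to a Parseval J-frame.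

  For the first fact, let \<open>R(z)\<close> be the resolvent of \<open>S\<close>. The contour lies in the right half-plane,
  where the divided difference of the square root, \<open>1 / (\<surd>z + \<surd>w)\<close>, is holomorphic in both variables.
  Multiplied by \<open>\<surd>z - \<surd>w\<close> and integrated in \<open>z\<close>, the resolvent identity becomes
  \<open>R(w) Q = \<surd>w R(w) - k(w)\<close> with \<open>k\<close> holomorphic on the whole half-plane (\<open>resolvent_sqrt\<close>).
  Integrating this along the contour against \<open>\<surd>w\<close> gives \<open>Q\<^sup>2 = S\<close> (\<open>sqrt_square\<close>), and
  integrating its adjoint against \<open>1\<close> gives \<open>Q\<^sup>+ = Q\<close> (\<open>sqrt_selfadjoint\<close>); the terms with \<open>k\<close>
  vanish by Cauchy's theorem. The only global input is \<open>1/(2\<pi>i) \<integral> R(z) dz = 1\<close>, which is the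
  residue of the resolvent at infinity (\<open>contour_integral_residue_at_infinity\<close>). All of this is done for
  the scalar functions \<open>[R(z) x, y]\<close>; that the operator-valued integral exists and has these weak
  values is a separate matter (\<open>kform_operator_contour_integral\<close>). Since the contour surrounds the
  spectrum inside the half-plane, \<open>0\<close> is not in the spectrum, so \<open>S\<close> and hence \<open>Q\<close> are invertible.

  For the second fact, \<open>S y = \<Sum> \<sigma>\<^sub>i [y, f\<^sub>i] f\<^sub>i\<close> with signs \<open>\<sigma>\<^sub>i\<close>, so that replacing
  \<open>f\<^sub>i\<close> by \<open>V f\<^sub>i\<close> replaces \<open>S\<close> by \<open>V S V = 1\<close>, provided that the signs stay the same.
  They do, because of the following estimate, the core of this part (\<open>kform_J_frame_operator_plus\<close>).
  Let \<open>M\<^sub>+\<close> and \<open>M\<^sub>-\<close> be the ranges of \<open>T\<^sub>+\<close> and \<open>T\<^sub>-\<close>. If \<open>m = S u\<close> is in \<open>M\<^sub>+\<close>, then its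
  component in \<open>M\<^sub>-\<close> vanishes, since the two subspaces meet only in \<open>0\<close>; hence
  \<open>[V m, V m] = [u, m] = \<Sum> \<bar>[u, f\<^sub>i]\<bar>\<^sup>2 \<ge> \<parallel>m\<parallel>\<^sup>2 / \<beta>\<close>, where \<open>\<beta>\<close> is the Bessel bound. So \<open>V M\<^sub>+\<close>
  is uniformly positive, and likewise \<open>V M\<^sub>-\<close> is uniformly negative. Together they span the space,
  because \<open>V S\<close> is onto, and complementary subspaces of opposite sign are maximal
  (\<open>J_frame_transformed\<close>).
\<close>

section \<open>Geometry of a Krein space\<close>

lemma kform_0_left [simp]: "kform 0 y = 0"
  using kform_scaleC_left [of 0 "0::'a" y] by simp

lemma kform_add_right: "kform x (y + z) = kform x y + kform x z"
  by (metis complex_cnj_add kform_add_left kform_hermitian)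

lemma kform_scaleC_right: "kform x (c *\<^sub>C y) = cnj c * kform x y"
  by (metis complex_cnj_mult kform_hermitian kform_scaleC_left)

lemma kform_0_right [simp]: "kform x 0 = 0"
  by (metis complex_cnj_zero kform_0_left kform_hermitian)

lemma kform_minus_left [simp]: "kform (- x) y = - kform x y"
  using kform_scaleC_left [of "-1" x y] by (simp add: cvec.scale_minus_left)

lemma kform_minus_right [simp]: "kform x (- y) = - kform x y"
  by (metis complex_cnj_minus kform_hermitian kform_minus_left)

lemma kform_diff_left: "kform (x - y) z = kform x z - kform y z"
  by (metis add_uminus_conv_diff kform_add_left kform_minus_left)

lemma kform_diff_right: "kform x (y - z) = kform x y - kform x z"
  by (metis add_uminus_conv_diff kform_add_right kform_minus_right)

lemma kform_sum_left: "kform (sum g F) y = (\<Sum>i\<in>F. kform (g i) y)"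
  by (induction F rule: infinite_finite_induct) (simp_all add: kform_add_left)

lemma Im_kform_self [simp]: "Im (kform x x) = 0"
  using arg_cong [OF kform_hermitian [of x x], of Im] by simp

lemma plus_part_unique:
  assumes "p \<in> Hplus" "x - p \<in> Hminus"
  shows "plus_part x = p"
  unfolding plus_part_def
proof (rule the_equality)
  show "p \<in> Hplus \<and> x - p \<in> Hminus" using assms by simp
next
  fix q assume q: "q \<in> Hplus \<and> x - q \<in> Hminus"
  have "q - p \<in> Hplus"
    using q assms cvec.subspace_diff [OF cvec_subspace_Hplus] by blast
  moreover have "(x - p) - (x - q) \<in> Hminus"
    using q assms cvec.subspace_diff [OF cvec_subspace_Hminus] by blast
  ultimately have "q - p \<in> Hplus \<inter> Hminus" by simp
  then show "q = p" by (simp add: Hplus_Hminus_direct)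
qed

lemma plus_part_sum_eq [simp]:
  "p \<in> Hplus \<Longrightarrow> m \<in> Hminus \<Longrightarrow> plus_part (p + m) = p"
  by (rule plus_part_unique) simp_all

lemma plus_part_mem [simp]: "plus_part x \<in> Hplus"
  and minus_part_mem [simp]: "minus_part x \<in> Hminus"
proof -
  obtain p m where "p \<in> Hplus" "m \<in> Hminus" "x = p + m"
    using Hplus_Hminus_span by blast
  then show "plus_part x \<in> Hplus" "minus_part x \<in> Hminus"
    by (simp_all add: minus_part_def)
qed

lemma plus_part_add_minus_part: "plus_part x + minus_part x = x"
  by (simp add: minus_part_def)

lemma plus_part_add: "plus_part (x + y) = plus_part x + plus_part y"
proof (rule plus_part_unique)
  show "x + y - (plus_part x + plus_part y) \<in> Hminus"
    using Hminus_add [OF minus_part_mem [of x] minus_part_mem [of y]]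
    by (simp add: minus_part_def algebra_simps)
qed (simp add: Hplus_add)

lemma plus_part_scaleC: "plus_part (c *\<^sub>C x) = c *\<^sub>C plus_part x"
proof (rule plus_part_unique)
  show "c *\<^sub>C x - c *\<^sub>C plus_part x \<in> Hminus"
    using Hminus_scaleC [OF minus_part_mem [of x], of c]
    by (simp add: minus_part_def cvec.scale_right_diff_distrib)
qed (simp add: Hplus_scaleC)

lemma minus_part_add: "minus_part (x + y) = minus_part x + minus_part y"
  by (simp add: minus_part_def plus_part_add)

lemma minus_part_scaleC: "minus_part (c *\<^sub>C x) = c *\<^sub>C minus_part x"
  by (simp add: minus_part_def plus_part_scaleC cvec.scale_right_diff_distrib)

text \<open>
  The fundamental symmetry turns the Krein form into the Hilbert inner product; it is the tool for
  moving estimates between the two.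
\<close>

definition fund_sym :: "'a::krein_space \<Rightarrow> 'a" where
  "fund_sym x = plus_part x - minus_part x"

lemma fund_sym_add: "fund_sym (x + y) = fund_sym x + fund_sym y"
  by (simp add: fund_sym_def plus_part_add minus_part_add)

lemma fund_sym_scaleC: "fund_sym (c *\<^sub>C x) = c *\<^sub>C fund_sym x"
  by (simp add: fund_sym_def plus_part_scaleC minus_part_scaleC cvec.scale_right_diff_distrib)

lemma kform_plus_minus_part [simp]:
  "kform (plus_part x) (minus_part y) = 0" "kform (minus_part x) (plus_part y) = 0"
proof -
  show *: "kform (plus_part x) (minus_part y) = 0" for x y :: 'a
    by (simp add: Hplus_Hminus_orthogonal)
  show "kform (minus_part x) (plus_part y) = 0"
    by (metis * complex_cnj_zero kform_hermitian)
qed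

lemma minus_in_Hminus: "- x \<in> Hminus" if "x \<in> Hminus" for x :: "'a::krein_space"
  using cvec.subspace_neg [OF cvec_subspace_Hminus that] .

lemma plus_part_fund_sym [simp]: "plus_part (fund_sym x) = plus_part x"
proof (rule plus_part_unique)
  show "fund_sym x - plus_part x \<in> Hminus"
    by (simp add: fund_sym_def minus_in_Hminus)
qed simp

lemma minus_part_fund_sym [simp]: "minus_part (fund_sym x) = - minus_part x"
  by (simp add: minus_part_def [of "fund_sym x"]) (simp add: fund_sym_def)

lemma fund_sym_fund_sym [simp]: "fund_sym (fund_sym x) = x"
  unfolding fund_sym_def [of "fund_sym x"] by (simp add: plus_part_add_minus_part)

lemma hinner_eq_kform_left: "hinner x y = kform (fund_sym x) y"
proof -
  have "kform (fund_sym x) (plus_part y + minus_part y) = hinner x y"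
    by (simp add: fund_sym_def hinner_def kform_diff_left kform_add_right)
  then show ?thesis by (simp add: plus_part_add_minus_part)
qed

lemma hinner_hermitian: "hinner y x = cnj (hinner x y)"
  by (simp add: hinner_def kform_hermitian [of "plus_part y"] kform_hermitian [of "minus_part y"])

lemma hinner_eq_kform_right: "hinner x y = kform x (fund_sym y)"
  by (metis hinner_eq_kform_left hinner_hermitian kform_hermitian)

lemma norm_sq_eq_hinner: "of_real ((norm x)\<^sup>2) = hinner x x"
proof (rule complex_eqI)
  have "0 \<le> Re (kform (plus_part x) (plus_part x))"
    using Hplus_pos_def [OF plus_part_mem, of x] by (cases "plus_part x = 0") auto
  moreover have "Re (kform (minus_part x) (minus_part x)) \<le> 0"
    using Hminus_neg_def [OF minus_part_mem, of x] by (cases "minus_part x = 0") auto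
  ultimately show "Re (of_real ((norm x)\<^sup>2)) = Re (hinner x x)"
    using norm_decomposition [OF plus_part_mem minus_part_mem, of x x]
    by (simp add: plus_part_add_minus_part hinner_def)
qed (simp add: hinner_def)

lemma norm_scaleC [simp]: "norm (c *\<^sub>C x) = cmod c * norm (x::'a::krein_space)"
proof -
  have "complex_of_real ((norm (c *\<^sub>C x))\<^sup>2) = c * cnj c * hinner x x"
    unfolding norm_sq_eq_hinner
    by (simp add: hinner_eq_kform_left fund_sym_scaleC kform_scaleC_left kform_scaleC_right)
  also have "\<dots> = of_real ((cmod c * norm x)\<^sup>2)"
    by (simp add: power_mult_distrib flip: norm_sq_eq_hinner complex_norm_square)
  finally have "complex_of_real ((norm (c *\<^sub>C x))\<^sup>2) = of_real ((cmod c * norm x)\<^sup>2)" .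
  then show ?thesis by (simp flip: of_real_power)
qed

lemma bounded_bilinear_scaleC:
  "bounded_bilinear (scaleC :: complex \<Rightarrow> 'a \<Rightarrow> 'a::krein_space)"
proof
  show "\<exists>K. \<forall>a b. norm (a *\<^sub>C b :: 'a) \<le> norm a * norm b * K"
    by (rule exI [of _ 1]) simp
  show "(r *\<^sub>R a) *\<^sub>C b = r *\<^sub>R (a *\<^sub>C b)" "a *\<^sub>C (r *\<^sub>R b) = r *\<^sub>R (a *\<^sub>C b)" for r a and b :: 'a
    by (simp_all add: scaleR_scaleC mult.commute scaleR_conv_of_real)
qed (simp_all add: scaleC_add_left scaleC_add_right)

lemma norm_fund_sym [simp]: "norm (fund_sym x) = norm x"
proof -
  have "complex_of_real ((norm (fund_sym x))\<^sup>2) = of_real ((norm x)\<^sup>2)"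
    by (simp add: norm_sq_eq_hinner hinner_def del: of_real_power)
  then show ?thesis by (simp flip: of_real_power)
qed

text \<open>
  Cauchy--Schwarz: the Hilbert norm of
  \<open>\<parallel>y\<parallel>\<^sup>2 x - \<langle>x, y\<rangle> y\<close> is nonnegative.
\<close>

lemma norm_hinner_le: "cmod (hinner x y) \<le> norm x * norm y"
proof (cases "y = 0")
  case True
  then show ?thesis by (simp add: hinner_eq_kform_left)
next
  case False
  define n where "n = complex_of_real ((norm y)\<^sup>2)"
  define h where "h = hinner x y"
  have n: "hinner y y = n" "cnj n = n"
    unfolding n_def norm_sq_eq_hinner by (simp_all flip: hinner_hermitian)
  have h: "hinner y x = cnj h"
    by (simp add: h_def flip: hinner_hermitian)
  let ?u = "n *\<^sub>C x - h *\<^sub>C y"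
  have fs: "fund_sym ?u = n *\<^sub>C fund_sym x - h *\<^sub>C fund_sym y"
    using fund_sym_add [of ?u "h *\<^sub>C y"] by (simp add: fund_sym_scaleC eq_diff_eq)
  have "complex_of_real ((norm ?u)\<^sup>2) = n * (n * hinner x x - h * cnj h)"
    unfolding norm_sq_eq_hinner hinner_eq_kform_left fs
    by (simp add: kform_diff_left kform_diff_right kform_scaleC_left kform_scaleC_right
        n h algebra_simps flip: h_def hinner_eq_kform_left)
  also have "\<dots> = of_real ((norm y)\<^sup>2 * ((norm y)\<^sup>2 * (norm x)\<^sup>2 - (cmod h)\<^sup>2))"
    by (simp add: n_def flip: norm_sq_eq_hinner complex_norm_square)
  finally have "0 \<le> (norm y)\<^sup>2 * ((norm y)\<^sup>2 * (norm x)\<^sup>2 - (cmod h)\<^sup>2)"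
    by (metis of_real_eq_iff zero_le_power2)
  then have "(cmod h)\<^sup>2 \<le> (norm x * norm y)\<^sup>2"
    using False by (simp add: zero_le_mult_iff power_mult_distrib mult.commute)
  then show ?thesis
    unfolding h_def by (rule power2_le_imp_le) simp
qed

lemma norm_kform_le: "cmod (kform x y) \<le> norm x * norm y"
  using norm_hinner_le [of "fund_sym x" y] by (simp add: hinner_eq_kform_left)

lemma kform_fund_sym_self: "kform x (fund_sym x) = of_real ((norm x)\<^sup>2)"
  unfolding norm_sq_eq_hinner hinner_eq_kform_right ..

lemma kform_nondegenerate: "(\<And>y. kform u y = kform v y) \<Longrightarrow> u = v"
  using kform_fund_sym_self [of "u - v"] by (simp add: kform_diff_left)

lemma bounded_linear_kform_left: "bounded_linear (\<lambda>x. kform x y)"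
proof (rule bounded_linear_intro)
  show "cmod (kform x y) \<le> norm x * norm y" for x by (rule norm_kform_le)
qed (simp_all add: kform_add_left scaleR_scaleC kform_scaleC_left flip: scaleR_conv_of_real)

text \<open>
  These bounds make the component sequences of a Cauchy sequence Cauchy, so that completeness of
  the two components gives completeness of the space.
\<close>

lemma norm_plus_part_le: "norm (plus_part x) \<le> norm x"
  and norm_minus_part_le: "norm (minus_part x) \<le> norm x"
proof -
  have "2 *\<^sub>R plus_part x = x + fund_sym x" "2 *\<^sub>R minus_part x = x - fund_sym x"
    by (simp_all add: fund_sym_def minus_part_def scaleR_2)
  then have "2 * norm (plus_part x) \<le> norm x + norm x" "2 * norm (minus_part x) \<le> norm x + norm x"
    using norm_triangle_ineq [of x "fund_sym x"] norm_triangle_ineq4 [of x "fund_sym x"]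
    by (metis norm_fund_sym norm_scaleR abs_numeral real_norm_def)+
  then show "norm (plus_part x) \<le> norm x" "norm (minus_part x) \<le> norm x" by simp_all
qed

lemma plus_part_diff: "plus_part (x - y) = plus_part x - plus_part y"
  using plus_part_add [of "x - y" y] by (simp add: eq_diff_eq)

lemma minus_part_diff: "minus_part (x - y) = minus_part x - minus_part y"
  using minus_part_add [of "x - y" y] by (simp add: eq_diff_eq)

instance krein_space \<subseteq> banach
proof
  fix X :: "nat \<Rightarrow> 'a" assume X: "Cauchy X"
  have "Cauchy (\<lambda>n. plus_part (X n))" "Cauchy (\<lambda>n. minus_part (X n))"
    using X norm_plus_part_le norm_minus_part_le order.strict_trans1
    unfolding Cauchy_iff plus_part_diff [symmetric] minus_part_diff [symmetric] by meson+
  then obtain p m where "(\<lambda>n. plus_part (X n)) \<longlonglongrightarrow> p" "(\<lambda>n. minus_part (X n)) \<longlonglongrightarrow> m"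
    using complete_Hplus complete_Hminus unfolding complete_def
    by (metis minus_part_mem plus_part_mem)
  then have "(\<lambda>n. plus_part (X n) + minus_part (X n)) \<longlonglongrightarrow> p + m"
    by (rule tendsto_add)
  then show "convergent X"
    by (auto simp: plus_part_add_minus_part convergent_def)
qed

section \<open>Invertible operators and the resolvent\<close>

lemma bounded_clinearI:
  fixes A :: "'a::krein_space \<Rightarrow> 'a"
  assumes "\<And>x y. A (x + y) = A x + A y" and "\<And>c x. A (c *\<^sub>C x) = c *\<^sub>C A x"
    and "\<And>x. norm (A x) \<le> K * norm x"
  shows "bounded_clinear A"
  unfolding bounded_clinear_def
  using assms by (auto intro!: bounded_linear_intro [of A K] simp: scaleR_scaleC mult.commute)

lemma bounded_clinear_fund_sym: "bounded_clinear fund_sym"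
  by (rule bounded_clinearI [of _ 1]) (simp_all add: fund_sym_add fund_sym_scaleC)

context
  fixes A :: "'a::krein_space \<Rightarrow> 'a"
  assumes A: "bounded_clinear A"
begin

lemma bounded_clinear_imp_bounded_linear: "bounded_linear A"
  using A by (simp add: bounded_clinear_def)

lemma bounded_clinear_add: "A (x + y) = A x + A y"
  using bounded_clinear_imp_bounded_linear by (rule linear_simps)

lemma bounded_clinear_diff: "A (x - y) = A x - A y"
  using bounded_clinear_imp_bounded_linear by (rule linear_simps)

lemma bounded_clinear_0: "A 0 = 0"
  using bounded_clinear_imp_bounded_linear by (rule linear_simps)

lemma bounded_clinear_scaleC: "A (c *\<^sub>C x) = c *\<^sub>C A x"
  using A by (simp add: bounded_clinear_def)

lemma bounded_clinear_bound:
  obtains K where "K > 0" "\<And>x. norm (A x) \<le> K * norm x"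
  using bounded_linear.pos_bounded [OF bounded_clinear_imp_bounded_linear]
  by (metis mult.commute)

end

lemmas bounded_clinear_simps =
  bounded_clinear_add bounded_clinear_diff bounded_clinear_0 bounded_clinear_scaleC

lemma bounded_clinear_subspace_image:
  assumes V: "bounded_clinear V" and M: "cvec.subspace M"
  shows "cvec.subspace (V ` M)"
proof (rule cvec.subspaceI)
  show "0 \<in> V ` M"
    using cvec.subspace_0 [OF M] bounded_clinear_0 [OF V] by (metis imageI)
  show "x + y \<in> V ` M" if "x \<in> V ` M" "y \<in> V ` M" for x y
    using that cvec.subspace_add [OF M] bounded_clinear_add [OF V]
    by (auto simp: image_iff) metis
  show "c *\<^sub>C x \<in> V ` M" if "x \<in> V ` M" for c x
    using that cvec.subspace_scale [OF M] bounded_clinear_scaleC [OF V]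
    by (auto simp: image_iff) metis
qed

lemma bounded_clinear_comp:
  "bounded_clinear A \<Longrightarrow> bounded_clinear B \<Longrightarrow> bounded_clinear (\<lambda>x. A (B x))"
  using bounded_linear_compose by (auto simp: bounded_clinear_def)

lemma bounded_clinear_scaleC_diff:
  assumes "bounded_clinear A"
  shows "bounded_clinear (\<lambda>x. z *\<^sub>C x - A x)"
  using assms bounded_linear_sub
    [OF bounded_bilinear.bounded_linear_right [OF bounded_bilinear_scaleC, of z]]
  by (auto simp: bounded_clinear_def scaleC_scaleC mult.commute cvec.scale_right_diff_distrib)

lemma bounded_clinear_add_scaleC:
  assumes "bounded_clinear A"
  shows "bounded_clinear (\<lambda>x. x + c *\<^sub>C A x)"
  using assms bounded_linear_add [OF bounded_linear_ident
      bounded_linear_compose [OF bounded_bilinear.bounded_linear_right [OF bounded_bilinear_scaleC, of c]]]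
  by (auto simp: bounded_clinear_def scaleC_scaleC mult.commute scaleC_add_right)

lemma invertible_op_obtain:
  assumes "invertible_op A"
  obtains B where "bounded_clinear B" "\<And>x. A (B x) = x" "\<And>x. B (A x) = x" "inv A = B"
proof -
  obtain B where B: "bounded_clinear B" "A \<circ> B = id" "B \<circ> A = id"
    using assms by (auto simp: invertible_op_def)
  then have "inv A = B" by (intro inv_unique_comp)
  with B that show ?thesis by (auto simp: fun_eq_iff)
qed

lemma invertible_opI:
  assumes "bounded_clinear A" "bounded_clinear B" "\<And>x. A (B x) = x" "\<And>x. B (A x) = x"
  shows "invertible_op A"
  using assms by (auto simp: invertible_op_def fun_eq_iff)

lemma invertible_op_imp_bounded_clinear: "invertible_op A \<Longrightarrow> bounded_clinear A"
  by (simp add: invertible_op_def)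

lemma invertible_op_inv: "invertible_op A \<Longrightarrow> invertible_op (inv A)"
  by (metis invertible_opI invertible_op_imp_bounded_clinear invertible_op_obtain)

lemma invertible_op_comp:
  assumes "invertible_op A" "invertible_op B"
  shows "invertible_op (\<lambda>x. A (B x))"
proof -
  obtain A' where A': "bounded_clinear A'" "\<And>x. A (A' x) = x" "\<And>x. A' (A x) = x"
    using invertible_op_obtain [OF assms(1)] by blast
  obtain B' where B': "bounded_clinear B'" "\<And>x. B (B' x) = x" "\<And>x. B' (B x) = x"
    using invertible_op_obtain [OF assms(2)] by blast
  show ?thesis
    by (rule invertible_opI [of _ "\<lambda>x. B' (A' x)"])
      (simp_all add: A' B' bounded_clinear_comp invertible_op_imp_bounded_clinear assms)
qed

lemma invertible_op_bounded_below:
  assumes "invertible_op A"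
  obtains c where "c > 0" "\<And>x. c * norm x \<le> norm (A x)"
proof -
  obtain B where B: "bounded_clinear B" "\<And>x. B (A x) = x"
    using invertible_op_obtain [OF assms] by blast
  obtain K where K: "K > 0" "\<And>x. norm (B x) \<le> K * norm x"
    using bounded_clinear_bound [OF B(1)] by blast
  have "inverse K * norm x \<le> norm (A x)" for x
    using K(1) K(2) [of "A x"] by (simp add: B field_simps)
  with K(1) that show ?thesis by (metis positive_imp_inverse_positive)
qed

lemma invertible_op_surjI:
  assumes A: "bounded_clinear A" and c: "c > 0" "\<And>x. c * norm x \<le> norm (A x)" and "surj A"
  shows "invertible_op A"
proof (rule invertible_opI [OF A])
  have "x = y" if "A x = A y" for x y
  proof -
    have "c * norm (x - y) \<le> norm (A (x - y))" by (rule c(2))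
    also have "\<dots> = 0" using that by (simp add: bounded_clinear_diff [OF A])
    finally show ?thesis using c(1) by (simp add: mult_le_0_iff)
  qed
  then have inj: "inj A" by (rule injI)
  show 1: "A (inv A x) = x" for x using \<open>surj A\<close> by (rule surj_f_inv_f)
  show 2: "inv A (A x) = x" for x using inj by (rule inv_f_f)
  show "bounded_clinear (inv A)"
  proof (rule bounded_clinearI)
    show "inv A (x + y) = inv A x + inv A y" for x y
      by (metis 1 2 A bounded_clinear_add)
    show "inv A (a *\<^sub>C x) = a *\<^sub>C inv A x" for a x
      by (metis 1 2 A bounded_clinear_scaleC)
    show "norm (inv A x) \<le> inverse c * norm x" for x
      using c(1) c(2) [of "inv A x"] by (simp add: 1 field_simps)
  qed
qed

lemma norm_diff_sq: "(norm (x - y))\<^sup>2 = (norm x)\<^sup>2 - 2 * Re (hinner y x) + (norm y)\<^sup>2"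
proof -
  have re: "Re (hinner u u) = (norm u)\<^sup>2" for u :: 'a
    by (simp flip: norm_sq_eq_hinner)
  have "Re (hinner (x - y) (x - y)) =
      Re (hinner x x) - (Re (hinner x y) + Re (hinner y x)) + Re (hinner y y)"
    by (simp add: hinner_eq_kform_right kform_diff_left kform_diff_right
        bounded_clinear_diff [OF bounded_clinear_fund_sym])
  moreover have "Re (hinner x y) = Re (hinner y x)"
    by (metis cnj.simps(1) hinner_hermitian)
  ultimately show ?thesis by (simp add: re)
qed

text \<open>
  Lax--Milgram: for small \<open>\<epsilon>\<close> the map \<open>x \<mapsto> x - \<epsilon> (B x - y)\<close> contracts, because
  \<open>\<parallel>x - \<epsilon> B x\<parallel>\<^sup>2 \<le> (1 - 2 \<epsilon> c + \<epsilon>\<^sup>2 b\<^sup>2) \<parallel>x\<parallel>\<^sup>2\<close>; its fixed point solves \<open>B x = y\<close>.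
  Both the openness of the resolvent set and the invertibility of adjoints are reduced to this.
\<close>

lemma coercive_imp_invertible:
  assumes B: "bounded_clinear B" and c: "c > 0" "\<And>x. c * (norm x)\<^sup>2 \<le> Re (hinner (B x) x)"
  shows "invertible_op B"
proof (rule invertible_op_surjI [OF B c(1)])
  show below: "c * norm x \<le> norm (B x)" for x
  proof (cases "x = 0")
    case False
    have "c * (norm x)\<^sup>2 \<le> norm (B x) * norm x"
      using c(2) [of x] complex_Re_le_cmod [of "hinner (B x) x"] norm_hinner_le [of "B x" x]
      by linarith
    with False show ?thesis by (simp add: power2_eq_square flip: mult.assoc)
  qed simp
  obtain b0 where b0: "b0 > 0" "\<And>x. norm (B x) \<le> b0 * norm x"
    using bounded_clinear_bound [OF B] by blast
  define b where "b = max b0 c"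
  have b: "b > 0" "c \<le> b" "norm (B x) \<le> b * norm x" for x
    using b0 c(1) mult_right_mono [of b0 b "norm x"] order_trans [OF b0(2)]
    by (auto simp: b_def less_max_iff_disj)
  define e where "e = c / b\<^sup>2"
  define q where "q = sqrt (1 - c\<^sup>2 / b\<^sup>2)"
  have cb: "0 < c\<^sup>2 / b\<^sup>2" "c\<^sup>2 / b\<^sup>2 \<le> 1"
    using b c(1) by (simp_all add: power_mono)
  have q: "0 \<le> q" "q < 1" "q\<^sup>2 = 1 - c\<^sup>2 / b\<^sup>2"
    using cb by (auto simp: q_def real_sqrt_lt_1_iff)
  have contr: "norm (x - of_real e *\<^sub>C B x) \<le> q * norm x" for x
  proof (rule power2_le_imp_le)
    have "(norm (x - of_real e *\<^sub>C B x))\<^sup>2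
        = (norm x)\<^sup>2 - 2 * (e * Re (hinner (B x) x)) + e\<^sup>2 * (norm (B x))\<^sup>2"
      by (simp add: norm_diff_sq hinner_eq_kform_right kform_scaleC_left power_mult_distrib)
    also have "\<dots> \<le> (norm x)\<^sup>2 - 2 * (e * (c * (norm x)\<^sup>2)) + e\<^sup>2 * (b * norm x)\<^sup>2"
      using c b by (intro add_mono diff_mono mult_left_mono power_mono) (auto simp: e_def)
    also have "\<dots> = (1 - 2 * (e * c) + e\<^sup>2 * b\<^sup>2) * (norm x)\<^sup>2"
      by (simp add: power_mult_distrib algebra_simps)
    also have "1 - 2 * (e * c) + e\<^sup>2 * b\<^sup>2 = q\<^sup>2"
      using b(1) unfolding q(3) e_def by (simp add: power2_eq_square)
    also have "q\<^sup>2 * (norm x)\<^sup>2 = (q * norm x)\<^sup>2"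
      by (simp add: power_mult_distrib)
    finally show "(norm (x - of_real e *\<^sub>C B x))\<^sup>2 \<le> (q * norm x)\<^sup>2" .
  qed (simp add: q)
  show "surj B"
  proof (rule surjI)
    fix y
    define g where "g x = x - of_real e *\<^sub>C (B x - y)" for x
    have "dist (g x) (g x') \<le> q * dist x x'" for x x'
    proof -
      have "g x - g x' = (x - x') - of_real e *\<^sub>C B (x - x')"
        by (simp add: g_def bounded_clinear_diff [OF B] cvec.scale_right_diff_distrib)
      then show ?thesis using contr by (simp add: dist_norm)
    qed
    then obtain x where "g x = x"
      using banach_fix_type [OF q(1,2), of g] by blast
    then have "B x = y"
      using b(1) c(1) by (simp add: g_def e_def cvec.scale_eq_0_iff)
    then show "B (SOME x. B x = y) = y" by (rule someI)
  qed
qed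

text \<open>
  With \<open>J\<close> the fundamental symmetry, \<open>J A J\<close> is the Hilbert space adjoint of \<open>A'\<close>, so
  \<open>\<langle>A' J A J x, x\<rangle> = \<parallel>A J x\<parallel>\<^sup>2\<close> and \<open>A' J A J\<close> is coercive; hence \<open>A'\<close> is onto.
\<close>

lemma invertible_op_adjoint:
  assumes A: "invertible_op A" and A': "bounded_clinear A'"
    and adj: "\<And>x y. kform (A x) y = kform x (A' y)"
  shows "invertible_op A'"
proof -
  obtain c where c: "c > 0" "\<And>x. c * norm x \<le> norm (A x)"
    using invertible_op_bounded_below [OF A] by blast
  have adj': "kform (A' x) y = kform x (A y)" for x y
    by (metis adj kform_hermitian)
  define B where "B x = A' (fund_sym (A (fund_sym x)))" for x
  have "invertible_op B"
  proof (rule coercive_imp_invertible)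
    show "bounded_clinear B"
      unfolding B_def using A' invertible_op_imp_bounded_clinear [OF A] bounded_clinear_fund_sym
      by (metis bounded_clinear_comp)
    have "hinner (B x) x = of_real ((norm (A (fund_sym x)))\<^sup>2)" for x
      using kform_fund_sym_self [of "fund_sym (A (fund_sym x))"]
      by (simp add: B_def hinner_eq_kform_right adj')
    moreover have "c\<^sup>2 * (norm x)\<^sup>2 \<le> (norm (A (fund_sym x)))\<^sup>2" for x
      using c power_mono [OF c(2) [of "fund_sym x"], of 2] by (simp add: power_mult_distrib)
    ultimately show "c\<^sup>2 * (norm x)\<^sup>2 \<le> Re (hinner (B x) x)" for x by simp
  qed (use c in simp)
  then obtain B' where "\<And>x. B (B' x) = x" using invertible_op_obtain by blast
  then have "surj A'" unfolding B_def by (rule surjI)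
  have "c * norm x \<le> norm (A' x)" for x
  proof (cases "x = 0")
    case False
    obtain u where u: "A u = fund_sym x" using invertible_op_obtain [OF A] by metis
    have "complex_of_real ((norm x)\<^sup>2) = kform (A' x) u"
      unfolding kform_fund_sym_self [symmetric] by (simp add: adj' u)
    then have "(norm x)\<^sup>2 \<le> norm (A' x) * norm u"
      by (metis norm_kform_le norm_of_real abs_power2)
    then have "c * (norm x)\<^sup>2 \<le> norm (A' x) * (c * norm u)"
      using c(1) by (simp add: mult.left_commute)
    also have "\<dots> \<le> norm (A' x) * norm x"
      using c(2) [of u] by (intro mult_left_mono) (simp_all add: u)
    finally have "c * (norm x)\<^sup>2 \<le> norm (A' x) * norm x" .
    with False show ?thesis by (simp add: power2_eq_square flip: mult.assoc)
  qed (simp add: bounded_clinear_0 [OF A'])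
  with \<open>surj A'\<close> show ?thesis by (intro invertible_op_surjI [OF A' c(1)])
qed

subsection \<open>The resolvent of a bounded operator\<close>

context
  fixes S :: "'a::krein_space \<Rightarrow> 'a"
  assumes S: "bounded_clinear S"
begin

lemma resolvent_props:
  assumes "z \<notin> op_spectrum S"
  shows bounded_clinear_resolvent: "bounded_clinear (resolvent S z)"
    and resolvent_right: "z *\<^sub>C resolvent S z x - S (resolvent S z x) = x"
    and resolvent_left: "resolvent S z (z *\<^sub>C x - S x) = x"
  using assms unfolding op_spectrum_def resolvent_def
  by (auto elim!: invertible_op_obtain)

lemma op_resolvent: "z \<notin> op_spectrum S \<Longrightarrow> S (resolvent S z x) = z *\<^sub>C resolvent S z x - x"
  using resolvent_right [of z x] by (simp add: algebra_simps)

lemma resolvent_identity: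
  assumes "z \<notin> op_spectrum S" "w \<notin> op_spectrum S"
  shows "resolvent S z x - resolvent S w x = (w - z) *\<^sub>C resolvent S w (resolvent S z x)"
proof -
  define u where "u = resolvent S z x"
  have "u = resolvent S w (w *\<^sub>C u - S u)"
    using resolvent_left [OF assms(2)] by simp
  also have "w *\<^sub>C u - S u = x + (w - z) *\<^sub>C u"
    by (simp add: u_def op_resolvent [OF assms(1)] cvec.scale_left_diff_distrib)
  also have "resolvent S w \<dots> = resolvent S w x + (w - z) *\<^sub>C resolvent S w u"
    by (simp add: bounded_clinear_simps [OF bounded_clinear_resolvent [OF assms(2)]])
  finally have "u - resolvent S w x = (w - z) *\<^sub>C resolvent S w u"
    by (simp only: diff_eq_eq add.commute)
  then show ?thesis by (simp add: u_def)
qed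

text \<open>
  \<open>z - S = (z\<^sub>0 - S) (1 + (z - z\<^sub>0) R(z\<^sub>0))\<close>, and the second factor is coercive for \<open>z\<close> close to
  \<open>z\<^sub>0\<close>. This is the openness of the resolvent set together with a local bound on the resolvent.
\<close>

lemma resolvent_locally_bounded:
  assumes z0: "z0 \<notin> op_spectrum S"
  obtains d M where "d > 0" "M > 0" "\<And>z. z \<in> ball z0 d \<Longrightarrow> z \<notin> op_spectrum S"
    "\<And>z x. z \<in> ball z0 d \<Longrightarrow> norm (resolvent S z x) \<le> M * norm x"
proof -
  have inv: "invertible_op (\<lambda>x. z0 *\<^sub>C x - S x)"
    using z0 by (simp add: op_spectrum_def)
  obtain K where K: "K > 0" "\<And>x. norm (resolvent S z0 x) \<le> K * norm x"
    using bounded_clinear_bound [OF bounded_clinear_resolvent [OF z0]] by blast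
  define d where "d = 1 / (2 * K)"
  have d: "d > 0" "d * K = 1 / 2" using K by (simp_all add: d_def)
  have spec: "z \<notin> op_spectrum S" if z: "z \<in> ball z0 d" for z
  proof -
    let ?B = "\<lambda>x. x + (z - z0) *\<^sub>C resolvent S z0 x"
    have "invertible_op ?B"
    proof (rule coercive_imp_invertible [of _ "1 / 2"])
      show "bounded_clinear ?B"
        by (intro bounded_clinear_add_scaleC bounded_clinear_resolvent z0)
      fix x
      have "cmod (hinner ((z - z0) *\<^sub>C resolvent S z0 x) x) \<le> cmod (z - z0) * (K * norm x) * norm x"
        using K(2) [of x] by (intro order_trans [OF norm_hinner_le] mult_right_mono)
          (auto intro: mult_left_mono)
      also have "\<dots> \<le> d * (K * norm x) * norm x"
        using z K(1) by (intro mult_right_mono) (auto simp: dist_norm norm_minus_commute)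
      also have "\<dots> = 1 / 2 * (norm x)\<^sup>2"
        using d(2) by (simp add: power2_eq_square flip: mult.assoc)
      finally have *: "cmod (hinner ((z - z0) *\<^sub>C resolvent S z0 x) x) \<le> 1 / 2 * (norm x)\<^sup>2" .
      have "hinner (?B x) x = of_real ((norm x)\<^sup>2) + hinner ((z - z0) *\<^sub>C resolvent S z0 x) x"
        unfolding norm_sq_eq_hinner by (simp add: hinner_eq_kform_right kform_add_left)
      then show "1 / 2 * (norm x)\<^sup>2 \<le> Re (hinner (?B x) x)"
        using * abs_Re_le_cmod [of "hinner ((z - z0) *\<^sub>C resolvent S z0 x) x"] by simp
    qed simp
    from invertible_op_comp [OF inv this]
    have "invertible_op (\<lambda>x. z0 *\<^sub>C ?B x - S (?B x))" .
    moreover have "z0 *\<^sub>C ?B x - S (?B x) = z *\<^sub>C x - S x" for x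
      by (simp add: bounded_clinear_simps [OF S] op_resolvent [OF z0])
        (simp add: algebra_simps cvec.scale_right_diff_distrib cvec.scale_left_diff_distrib
          scaleC_add_right scaleC_scaleC mult.commute)
    ultimately show ?thesis by (simp add: op_spectrum_def)
  qed
  have "norm (resolvent S z x) \<le> (2 * K) * norm x" if z: "z \<in> ball z0 d" for z x
  proof -
    let ?u = "resolvent S z x"
    have "resolvent S z0 x - ?u = (z - z0) *\<^sub>C resolvent S z0 ?u"
      using resolvent_identity [OF spec [OF z] z0, of x]
      by (metis minus_diff_eq cvec.scale_minus_left)
    then have "?u = resolvent S z0 x - (z - z0) *\<^sub>C resolvent S z0 ?u"
      by (simp add: algebra_simps)
    then have "norm ?u \<le> norm (resolvent S z0 x) + cmod (z - z0) * norm (resolvent S z0 ?u)"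
      by (metis norm_scaleC norm_triangle_ineq4)
    also have "\<dots> \<le> K * norm x + d * (K * norm ?u)"
      using z K d by (intro add_mono mult_mono) (auto simp: dist_norm norm_minus_commute)
    also have "d * (K * norm ?u) = norm ?u / 2" using d(2) by (simp flip: mult.assoc)
    finally show ?thesis by simp
  qed
  with d K spec that [of d "2 * K"] show ?thesis by simp
qed

lemma closed_op_spectrum: "closed (op_spectrum S)"
proof -
  have "\<exists>d>0. ball z d \<subseteq> - op_spectrum S" if "z \<in> - op_spectrum S" for z
    using that resolvent_locally_bounded [of z] by (metis ComplD ComplI subsetI)
  then show ?thesis by (auto simp: closed_def open_contains_ball)
qed

lemma resolvent_Lipschitz:
  assumes z0: "z0 \<notin> op_spectrum S"
  obtains d L where "d > 0" "L > 0" "\<And>z. z \<in> ball z0 d \<Longrightarrow> z \<notin> op_spectrum S"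
    "\<And>z x. z \<in> ball z0 d \<Longrightarrow> norm (resolvent S z x - resolvent S z0 x) \<le> L * cmod (z - z0) * norm x"
proof -
  obtain d M where d: "d > 0" "M > 0" "\<And>z. z \<in> ball z0 d \<Longrightarrow> z \<notin> op_spectrum S"
    "\<And>z x. z \<in> ball z0 d \<Longrightarrow> norm (resolvent S z x) \<le> M * norm x"
    using resolvent_locally_bounded [OF z0] by blast
  have "norm (resolvent S z x - resolvent S z0 x) \<le> M * M * cmod (z - z0) * norm x"
    if z: "z \<in> ball z0 d" for z x
  proof -
    have "norm (resolvent S z x - resolvent S z0 x)
        = cmod (z - z0) * norm (resolvent S z0 (resolvent S z x))"
      using resolvent_identity [OF d(3) [OF z] z0, of x] by (simp add: norm_minus_commute)
    also have "\<dots> \<le> cmod (z - z0) * (M * (M * norm x))"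
      using d(1,2) d(4) [of z0 "resolvent S z x"] d(4) [OF z, of x]
      by (intro mult_left_mono) (auto elim!: order_trans)
    finally show ?thesis by (simp add: mult_ac)
  qed
  with d that [of d "M * M"] show ?thesis by simp
qed

lemma continuous_on_resolvent: "continuous_on (- op_spectrum S) (\<lambda>z. Blinfun (resolvent S z))"
proof -
  have "isCont (\<lambda>z. Blinfun (resolvent S z)) z0" if z0: "z0 \<notin> op_spectrum S" for z0
  proof -
    obtain d L where d: "d > 0" "L > 0" "\<And>z. z \<in> ball z0 d \<Longrightarrow> z \<notin> op_spectrum S"
      "\<And>z x. z \<in> ball z0 d \<Longrightarrow> norm (resolvent S z x - resolvent S z0 x) \<le> L * cmod (z - z0) * norm x"
      using resolvent_Lipschitz [OF z0] by blast
    have app: "blinfun_apply (Blinfun (resolvent S z)) = resolvent S z" if "z \<in> ball z0 d" for z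
      using d(3) [OF that] by (intro bounded_linear_Blinfun_apply
          bounded_clinear_imp_bounded_linear bounded_clinear_resolvent)
    have "norm (Blinfun (resolvent S z) - Blinfun (resolvent S z0)) \<le> L * cmod (z - z0)"
      if "z \<in> ball z0 d" for z
      by (rule norm_blinfun_bound)
        (use d that in \<open>auto simp: app minus_blinfun.rep_eq\<close>)
    then have "\<forall>\<^sub>F z in at z0. norm (Blinfun (resolvent S z) - Blinfun (resolvent S z0))
        \<le> L * cmod (z - z0)"
      using d(1) by (auto simp: eventually_at dist_commute intro!: exI [of _ d])
    moreover have "((\<lambda>z. L * cmod (z - z0)) \<longlongrightarrow> 0) (at z0)"
      by (auto intro!: tendsto_eq_intros)
    ultimately have "((\<lambda>z. Blinfun (resolvent S z) - Blinfun (resolvent S z0)) \<longlongrightarrow> 0) (at z0)"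
      by (rule Lim_null_comparison)
    then show ?thesis by (simp add: isCont_def LIM_zero_iff)
  qed
  then show ?thesis by (auto intro: continuous_at_imp_continuous_on)
qed

lemma holomorphic_kform_resolvent:
  "(\<lambda>z. kform (resolvent S z x) y) holomorphic_on - op_spectrum S"
proof (rule holomorphic_onI)
  fix z0 assume "z0 \<in> - op_spectrum S"
  then have z0: "z0 \<notin> op_spectrum S" by simp
  obtain d L where d: "d > 0" "L > 0" "\<And>z. z \<in> ball z0 d \<Longrightarrow> z \<notin> op_spectrum S"
    "\<And>z x. z \<in> ball z0 d \<Longrightarrow> norm (resolvent S z x - resolvent S z0 x) \<le> L * cmod (z - z0) * norm x"
    using resolvent_Lipschitz [OF z0] by blast
  have near: "\<forall>\<^sub>F z in at z0. z \<in> ball z0 d \<and> z \<noteq> z0"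
    using d(1) by (auto simp: eventually_at dist_commute intro!: exI [of _ d])
  let ?u = "resolvent S z0 x"
  have "((\<lambda>z. L * cmod (z - z0) * norm ?u) \<longlongrightarrow> 0) (at z0)"
    by (auto intro!: tendsto_eq_intros)
  moreover have "\<forall>\<^sub>F z in at z0. norm (resolvent S z ?u - resolvent S z0 ?u) \<le> L * cmod (z - z0) * norm ?u"
    using near by eventually_elim (use d(4) in blast)
  ultimately have "((\<lambda>z. resolvent S z ?u - resolvent S z0 ?u) \<longlongrightarrow> 0) (at z0)"
    by (rule Lim_null_comparison [rotated])
  then have "((\<lambda>z. resolvent S z ?u) \<longlongrightarrow> resolvent S z0 ?u) (at z0)"
    by (simp add: LIM_zero_iff)
  then have lim: "((\<lambda>z. - kform (resolvent S z ?u) y) \<longlongrightarrow> - kform (resolvent S z0 ?u) y) (at z0)"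
    by (intro tendsto_minus bounded_linear.tendsto [OF bounded_linear_kform_left])
  have "\<forall>\<^sub>F z in at z0.
      - kform (resolvent S z ?u) y = (kform (resolvent S z x) y - kform ?u y) / (z - z0)"
    using near
  proof eventually_elim
    case (elim z)
    have "?u - resolvent S z x = (z - z0) *\<^sub>C resolvent S z ?u"
      using resolvent_identity [OF z0 d(3)] elim by blast
    then have "kform ?u y - kform (resolvent S z x) y = (z - z0) * kform (resolvent S z ?u) y"
      by (metis kform_diff_left kform_scaleC_left)
    with elim show ?case by (simp add: field_simps)
  qed
  with lim have "((\<lambda>z. kform (resolvent S z x) y) has_field_derivative
      - kform (resolvent S z0 ?u) y) (at z0)"
    unfolding has_field_derivative_iff by (simp add: tendsto_cong)
  then show "(\<lambda>z. kform (resolvent S z x) y) field_differentiable at z0 within - op_spectrum S"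
    using field_differentiable_at_within field_differentiable_def by blast
qed

text \<open>Far out, \<open>\<parallel>(z - S) u\<parallel> \<ge> (\<bar>z\<bar> - \<parallel>S\<parallel>) \<parallel>u\<parallel>\<close>.\<close>

lemma resolvent_tendsto_0:
  assumes "bounded (op_spectrum S)"
  shows "((\<lambda>z. resolvent S z x) \<longlongrightarrow> 0) at_infinity"
proof -
  obtain K where K: "K > 0" "\<And>x. norm (S x) \<le> K * norm x"
    using bounded_clinear_bound [OF S] by blast
  obtain r where r: "\<And>z. z \<in> op_spectrum S \<Longrightarrow> cmod z \<le> r"
    using assms by (auto simp: bounded_iff)
  have "norm (resolvent S z x) \<le> norm x / (cmod z - K)" if "cmod z > max r K" for z
  proof -
    have "z \<notin> op_spectrum S" using that r by fastforce
    from resolvent_right [OF this, of x]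
    have "norm (z *\<^sub>C resolvent S z x) - norm (S (resolvent S z x)) \<le> norm x"
      by (metis norm_triangle_ineq2)
    then have "(cmod z - K) * norm (resolvent S z x) \<le> norm x"
      using K(2) [of "resolvent S z x"] by (simp add: left_diff_distrib)
    with that show ?thesis by (simp add: field_simps)
  qed
  then have "\<forall>\<^sub>F z in at_infinity. norm (resolvent S z x) \<le> norm x / (cmod z - K)"
    unfolding eventually_at_infinity
    by (metis add_le_cancel_left less_add_one order.strict_trans2)
  moreover have "((\<lambda>z. norm x / (cmod z - K)) \<longlongrightarrow> 0) at_infinity"
  proof (rule real_tendsto_divide_at_top [OF tendsto_const])
    show "filterlim (\<lambda>z::complex. cmod z - K) at_top at_infinity"
      using filterlim_tendsto_add_at_top [OF tendsto_const filterlim_norm_at_top, of "- K"]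
      by simp
  qed
  ultimately show ?thesis by (rule Lim_null_comparison)
qed

end

lemma op_spectrum_cnj:
  assumes S: "bounded_clinear S" and sa: "\<And>x y. kform (S x) y = kform x (S y)"
    and z: "z \<notin> op_spectrum S"
  shows "cnj z \<notin> op_spectrum S"
proof -
  have "invertible_op (\<lambda>x. cnj z *\<^sub>C x - S x)"
  proof (rule invertible_op_adjoint [OF _ bounded_clinear_scaleC_diff [OF S]])
    show "invertible_op (\<lambda>x. z *\<^sub>C x - S x)"
      using z by (simp add: op_spectrum_def)
  qed (simp add: kform_diff_left kform_diff_right kform_scaleC_left kform_scaleC_right sa)
  then show ?thesis by (simp add: op_spectrum_def)
qed

lemma kform_resolvent:
  assumes S: "bounded_clinear S" and sa: "\<And>x y. kform (S x) y = kform x (S y)"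
    and z: "z \<notin> op_spectrum S"
  shows "kform (resolvent S z x) y = kform x (resolvent S (cnj z) y)"
proof -
  let ?u = "resolvent S z x" and ?v = "resolvent S (cnj z) y"
  have "kform ?u (cnj z *\<^sub>C ?v - S ?v) = kform (z *\<^sub>C ?u - S ?u) ?v"
    by (simp add: kform_diff_left kform_diff_right kform_scaleC_left kform_scaleC_right sa)
  then show ?thesis
    using resolvent_right [OF S z, of x] resolvent_right [OF S op_spectrum_cnj [OF S sa z], of y]
    by simp
qed

section \<open>Contour integrals of operator-valued functions\<close>

definition cscale_op :: "complex \<Rightarrow> ('a::krein_space \<Rightarrow>\<^sub>L 'a) \<Rightarrow> 'a \<Rightarrow>\<^sub>L 'a" where
  "cscale_op c A = Blinfun (\<lambda>x. c *\<^sub>C blinfun_apply A x)"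

lemma cscale_op_apply [simp]: "blinfun_apply (cscale_op c A) x = c *\<^sub>C blinfun_apply A x"
  unfolding cscale_op_def
  by (simp add: bounded_linear_Blinfun_apply bounded_linear_compose
      [OF bounded_bilinear.bounded_linear_right [OF bounded_bilinear_scaleC]]
      blinfun.bounded_linear_right)

lemma bounded_bilinear_cscale_op:
  "bounded_bilinear (cscale_op :: complex \<Rightarrow> ('a::krein_space \<Rightarrow>\<^sub>L 'a) \<Rightarrow> _)"
proof
  show "\<exists>K. \<forall>c (A :: 'a \<Rightarrow>\<^sub>L 'a). norm (cscale_op c A) \<le> norm c * norm A * K"
    by (rule exI [of _ 1])
      (auto intro!: norm_blinfun_bound mult_left_mono norm_blinfun simp: mult.assoc)
qed (auto intro!: blinfun_eqI simp: blinfun.bilinear_simps scaleC_add_left scaleC_add_right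
      scaleR_scaleC scaleC_scaleC scaleR_conv_of_real mult.commute)

interpretation cscale_op: bounded_bilinear cscale_op
  by (rule bounded_bilinear_cscale_op)

lemma bounded_linear_kform_blinfun: "bounded_linear (\<lambda>A. kform (blinfun_apply A x) y)"
  by (rule bounded_linear_compose [OF bounded_linear_kform_left blinfun.bounded_linear_left])

lemma blinfun_eqI_kform:
  "(\<And>x y. kform (blinfun_apply A x) y = kform (blinfun_apply B x) y) \<Longrightarrow> A = B"
  by (intro blinfun_eqI kform_nondegenerate)

text \<open>
  A valid path may have an unbounded derivative, so continuity of the integrand does not give
  integrability along it. As for scalar functions, the remedy is a local primitive. It is built by
  integrating along straight segments, where integrability is no issue; that it is a primitive
  needs Cauchy's theorem only after applying the functionals \<open>A \<mapsto> [A x, y]\<close>,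
  which separate operators.
\<close>

definition segment_integral ::
    "(complex \<Rightarrow> 'a::krein_space \<Rightarrow>\<^sub>L 'a) \<Rightarrow> complex \<Rightarrow> complex \<Rightarrow> 'a \<Rightarrow>\<^sub>L 'a" where
  "segment_integral F a b = integral {0..1} (\<lambda>t. cscale_op (b - a) (F (linepath a b t)))"

lemma segment_integrable:
  assumes "continuous_on D F" "closed_segment a b \<subseteq> D"
  shows "(\<lambda>t. cscale_op c (F (linepath a b t))) integrable_on {0..1}"
proof (rule integrable_continuous_interval)
  have "continuous_on {0..1} (\<lambda>t. F (linepath a b t))"
    by (rule continuous_on_compose2 [OF assms(1)])
      (use assms(2) linepath_in_path subsetD in \<open>fastforce intro!: continuous_on_linepath\<close>)+
  then show "continuous_on {0..1} (\<lambda>t. cscale_op c (F (linepath a b t)))"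
    by (intro cscale_op.continuous_on continuous_on_const)
qed

lemma kform_segment_integral:
  assumes "continuous_on D F" "closed_segment a b \<subseteq> D"
  shows "kform (blinfun_apply (segment_integral F a b) x) y =
    contour_integral (linepath a b) (\<lambda>z. kform (blinfun_apply (F z) x) y)"
  using integral_linear [OF segment_integrable [OF assms, of "b - a"]
      bounded_linear_kform_blinfun [of x y]]
  by (simp add: segment_integral_def contour_integral_integral o_def kform_scaleC_left mult.commute)

lemma operator_primitive:
  fixes F :: "complex \<Rightarrow> 'a::krein_space \<Rightarrow>\<^sub>L 'a"
  assumes D: "convex D" "open D" and cont: "continuous_on D F"
    and hol: "\<And>x y. (\<lambda>z. kform (blinfun_apply (F z) x) y) holomorphic_on D"
    and a: "a \<in> D" and z: "z \<in> D"
  shows "(segment_integral F a has_derivative (\<lambda>h. cscale_op h (F z))) (at z)"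
  unfolding has_derivative_at_alt
proof (intro conjI allI impI)
  show "bounded_linear (\<lambda>h. cscale_op h (F z))"
    by (rule cscale_op.bounded_linear_left)
next
  have seg: "closed_segment u v \<subseteq> D" if "u \<in> D" "v \<in> D" for u v
    using D(1) that by (simp add: closed_segment_subset)
  have diff: "segment_integral F a v - segment_integral F a u = segment_integral F u v"
    if "u \<in> D" "v \<in> D" for u v
  proof (rule blinfun_eqI_kform)
    fix x y
    obtain g where g: "\<And>w. w \<in> D \<Longrightarrow>
        (g has_field_derivative kform (blinfun_apply (F w) x) y) (at w within D)"
      using holomorphic_convex_primitive' [OF D hol [of x y]] by blast
    have *: "kform (blinfun_apply (segment_integral F p q) x) y = g q - g p"
      if "p \<in> D" "q \<in> D" for p q
      unfolding kform_segment_integral [OF cont seg [OF that]]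
      using contour_integral_primitive [OF g, of "linepath p q"] seg [OF that]
      by (simp add: contour_integral_unique)
    show "kform (blinfun_apply (segment_integral F a v - segment_integral F a u) x) y =
        kform (blinfun_apply (segment_integral F u v) x) y"
      using a that by (simp add: * blinfun.diff_left kform_diff_left)
  qed
  fix e :: real assume "e > 0"
  obtain K where K: "K > 0" "\<And>c (A :: 'a \<Rightarrow>\<^sub>L 'a). norm (cscale_op c A) \<le> norm c * norm A * K"
    using cscale_op.pos_bounded by blast
  obtain d1 where d1: "d1 > 0" "\<And>w. w \<in> D \<Longrightarrow> dist w z < d1 \<Longrightarrow> dist (F w) (F z) < e / K"
    using cont z divide_pos_pos [OF \<open>e > 0\<close> K(1)] unfolding continuous_on_iff by blast
  obtain d2 where d2: "d2 > 0" "ball z d2 \<subseteq> D"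
    using D(2) z by (auto simp: open_contains_ball)
  have "norm (segment_integral F a w - segment_integral F a z - cscale_op (w - z) (F z))
      \<le> e * norm (w - z)" if w: "norm (w - z) < min d1 d2" for w
  proof -
    have wD: "w \<in> D" using w d2 by (auto simp: dist_norm norm_minus_commute)
    let ?f = "\<lambda>t. cscale_op (w - z) (F (linepath z w t)) - cscale_op (w - z) (F z)"
    have "((\<lambda>t. cscale_op (w - z) (F (linepath z w t))) has_integral segment_integral F z w) {0..1}"
      unfolding segment_integral_def
      by (intro integrable_integral segment_integrable [OF cont seg [OF z wD]])
    moreover have "((\<lambda>t. cscale_op (w - z) (F z)) has_integral cscale_op (w - z) (F z)) {0..1::real}"
      using has_integral_const_real [of "cscale_op (w - z) (F z)" 0 1] by simp
    ultimately have int: "(?f has_integral (segment_integral F z w - cscale_op (w - z) (F z))) {0..1}"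
      by (rule has_integral_diff)
    have "norm (?f t) \<le> e * norm (w - z)" if t: "t \<in> {0..1}" for t
    proof -
      have "linepath z w t - z = of_real t * (w - z)"
        by (simp add: linepath_def scaleR_conv_of_real algebra_simps)
      then have "dist (linepath z w t) z \<le> norm (w - z)"
        using t by (simp add: dist_norm norm_mult mult_left_le_one_le)
      moreover have "linepath z w t \<in> D"
        using t seg [OF z wD] linepath_in_path by blast
      ultimately have "norm (F (linepath z w t) - F z) \<le> e / K"
        using d1(2) [of "linepath z w t"] w by (simp add: dist_norm)
      have "norm (?f t) \<le> norm (w - z) * norm (F (linepath z w t) - F z) * K"
        using K(2) by (simp flip: cscale_op.diff_right)
      also have "\<dots> \<le> norm (w - z) * (e / K) * K"
        using K(1) \<open>norm (F (linepath z w t) - F z) \<le> e / K\<close>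
        by (intro mult_right_mono mult_left_mono) auto
      finally show ?thesis using K(1) by (simp add: mult.commute)
    qed
    then have "norm (segment_integral F z w - cscale_op (w - z) (F z)) \<le> e * norm (w - z) * measure lborel {0..1::real}"
      using \<open>e > 0\<close> by (intro has_integral_bound_real [OF _ finite.emptyI int]) auto
    then show ?thesis by (simp add: diff [OF z wD])
  qed
  then show "\<exists>d>0. \<forall>w. norm (w - z) < d \<longrightarrow>
      norm (segment_integral F a w - segment_integral F a z - cscale_op (w - z) (F z)) \<le> e * norm (w - z)"
    using d1(1) d2(1) by (intro exI [of _ "min d1 d2"]) auto
qed

context
  fixes F :: "complex \<Rightarrow> 'a::krein_space \<Rightarrow>\<^sub>L 'a" and \<Omega> :: "complex set" and \<gamma> :: "real \<Rightarrow> complex"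
  assumes opn: "open \<Omega>" and cont: "continuous_on \<Omega> F"
    and hol: "\<And>x y. (\<lambda>z. kform (blinfun_apply (F z) x) y) holomorphic_on \<Omega>"
    and \<gamma>: "valid_path \<gamma>" "path_image \<gamma> \<subseteq> \<Omega>"
begin

lemma operator_contour_integrable:
  "(\<lambda>t. cscale_op (vector_derivative \<gamma> (at t within {0..1})) (F (\<gamma> t))) integrable_on {0..1}"
    (is "?f integrable_on _")
proof -
  obtain K where K: "finite K" "\<gamma> C1_differentiable_on {0..1} - K" and cg: "continuous_on {0..1} \<gamma>"
    using \<gamma>(1) by (auto simp: valid_path_def piecewise_C1_differentiable_on_def)
  have "\<exists>d>0. \<forall>u v. s \<in> cbox u v \<and> cbox u v \<subseteq> ball s d \<and> cbox u v \<subseteq> cbox 0 1 \<longrightarrow>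
      ?f integrable_on cbox u v" if s: "s \<in> cbox 0 1" for s
  proof -
    have "\<gamma> s \<in> \<Omega>" using \<gamma>(2) s by (auto simp: path_image_def)
    then obtain r where r: "r > 0" "ball (\<gamma> s) r \<subseteq> \<Omega>"
      using opn by (auto simp: open_contains_ball)
    let ?D = "ball (\<gamma> s) r"
    let ?G = "segment_integral F (\<gamma> s)"
    have G: "(?G has_derivative (\<lambda>h. cscale_op h (F z))) (at z)" if "z \<in> ?D" for z
      using r that by (intro operator_primitive [of ?D])
        (auto intro: continuous_on_subset [OF cont] holomorphic_on_subset [OF hol])
    obtain d where d: "d > 0" "\<And>t. t \<in> {0..1} \<Longrightarrow> dist t s < d \<Longrightarrow> dist (\<gamma> t) (\<gamma> s) < r"
      using cg s r(1) unfolding continuous_on_iff by (metis box_real(2))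
    have "?f integrable_on {u..v}" if uv: "s \<in> {u..v}" "{u..v} \<subseteq> ball s d" "{u..v} \<subseteq> {0..1}" for u v
    proof -
      have sub: "\<gamma> t \<in> ?D" if "t \<in> {u..v}" for t
        using that uv d(2) [of t] by (auto simp: dist_commute subset_iff)
      have "(?f has_integral (?G (\<gamma> v) - ?G (\<gamma> u))) {u..v}"
      proof (rule fundamental_theorem_of_calculus_interior_strong [OF K(1)])
        show "u \<le> v" using uv by auto
        show "((\<lambda>t. ?G (\<gamma> t)) has_vector_derivative ?f t) (at t)" if t: "t \<in> {u<..<v} - K" for t
        proof -
          have "t \<in> {0..1} - K" using t uv by auto
          then have \<gamma>': "(\<gamma> has_vector_derivative vector_derivative \<gamma> (at t)) (at t)"
            using K(2) by (simp add: C1_differentiable_on_eq vector_derivative_works)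
          have "vector_derivative \<gamma> (at t within {0..1}) = vector_derivative \<gamma> (at t)"
            using \<open>t \<in> {0..1} - K\<close> by (intro vector_derivative_at_within_ivl [OF \<gamma>']) auto
          moreover have "\<gamma> t \<in> ?D" using sub t by simp
          ultimately show ?thesis
            using diff_chain_at [OF \<gamma>' [unfolded has_vector_derivative_def] G]
            by (simp add: has_vector_derivative_def o_def cscale_op.scaleR_left)
        qed
        have "continuous_on ?D ?G"
          by (rule has_derivative_continuous_on [OF has_derivative_at_withinI [OF G]])
        then show "continuous_on {u..v} (\<lambda>t. ?G (\<gamma> t))"
          by (rule continuous_on_compose2) (use sub uv cg in \<open>auto intro: continuous_on_subset\<close>)
      qed
      then show ?thesis by (rule has_integral_integrable)
    qed
    with d(1) show ?thesis by auto
  qed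
  then have "?f integrable_on cbox 0 1" by (intro integrable_on_little_subintervals) blast
  then show ?thesis by simp
qed

lemma kform_operator_contour_integral:
  "kform (blinfun_apply (integral {0..1}
      (\<lambda>t. cscale_op (vector_derivative \<gamma> (at t within {0..1})) (F (\<gamma> t)))) x) y =
    contour_integral \<gamma> (\<lambda>z. kform (blinfun_apply (F z) x) y)"
proof -
  obtain K where K: "finite K" "\<gamma> C1_differentiable_on {0..1} - K"
    using \<gamma>(1) by (auto simp: valid_path_def piecewise_C1_differentiable_on_def)
  have "kform (blinfun_apply (integral {0..1}
      (\<lambda>t. cscale_op (vector_derivative \<gamma> (at t within {0..1})) (F (\<gamma> t)))) x) y =
    integral {0..1} (\<lambda>t. vector_derivative \<gamma> (at t within {0..1}) * kform (blinfun_apply (F (\<gamma> t)) x) y)"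
    using integral_linear [OF operator_contour_integrable bounded_linear_kform_blinfun [of x y]]
    by (simp add: o_def kform_scaleC_left)
  also have "\<dots> = integral {0..1} (\<lambda>t. kform (blinfun_apply (F (\<gamma> t)) x) y * vector_derivative \<gamma> (at t))"
  proof (rule integral_spike [OF negligible_finite [OF K(1)]])
    fix t assume t: "t \<in> {0..1} - K"
    then have \<gamma>': "(\<gamma> has_vector_derivative vector_derivative \<gamma> (at t)) (at t)"
      using K(2) by (simp add: C1_differentiable_on_eq vector_derivative_works)
    have "vector_derivative \<gamma> (at t within {0..1}) = vector_derivative \<gamma> (at t)"
      using t by (intro vector_derivative_at_within_ivl [OF \<gamma>']) auto
    then show "kform (blinfun_apply (F (\<gamma> t)) x) y * vector_derivative \<gamma> (at t) =
        vector_derivative \<gamma> (at t within {0..1}) * kform (blinfun_apply (F (\<gamma> t)) x) y"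
      by simp
  qed
  finally show ?thesis by (simp add: contour_integral_integral)
qed

end

lemma Re_pos_imp_csqrt_Re_pos: "Re z > 0 \<Longrightarrow> Re (csqrt z) > 0"
  using norm_ge_zero [of z] by (simp del: norm_ge_zero)

lemma holomorphic_on_csqrt_right_half_plane: "csqrt holomorphic_on {z. Re z > 0}"
  by (rule holomorphic_on_subset [OF holomorphic_on_csqrt]) (auto simp: complex_nonpos_Reals_iff)

lemma
  assumes S: "bounded_clinear S"
    and \<gamma>: "valid_path \<gamma>" "path_image \<gamma> \<subseteq> {z. Re z > 0} - op_spectrum S"
  shows kform_contour_sqrt: "kform (contour_sqrt \<gamma> S x) y =
      1 / (2 * of_real pi * \<i>) * contour_integral \<gamma> (\<lambda>z. csqrt z * kform (resolvent S z x) y)"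
    and bounded_clinear_contour_sqrt: "bounded_clinear (contour_sqrt \<gamma> S)"
proof -
  let ?\<Omega> = "{z. Re z > 0} - op_spectrum S"
  define F where "F z = cscale_op (csqrt z) (Blinfun (resolvent S z))" for z
  have app: "blinfun_apply (Blinfun (resolvent S z)) = resolvent S z" if "z \<in> ?\<Omega>" for z
    using that by (intro bounded_linear_Blinfun_apply
      bounded_clinear_imp_bounded_linear bounded_clinear_resolvent [OF S]) auto
  have F_app: "blinfun_apply (F z) x = csqrt z *\<^sub>C resolvent S z x" if "z \<in> ?\<Omega>" for z x
    by (simp add: F_def app [OF that])
  have opn: "open ?\<Omega>"
    by (intro open_Diff open_halfspace_Re_gt closed_op_spectrum S)
  have cont: "continuous_on ?\<Omega> F"
    unfolding F_def
    by (intro cscale_op.continuous_on continuous_on_subset [OF continuous_on_resolvent [OF S]]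
        continuous_on_subset [OF holomorphic_on_imp_continuous_on
          [OF holomorphic_on_csqrt_right_half_plane]]) auto
  have hol: "(\<lambda>z. kform (blinfun_apply (F z) x) y) holomorphic_on ?\<Omega>" for x y
  proof -
    have "(\<lambda>z. csqrt z * kform (resolvent S z x) y) holomorphic_on ?\<Omega>"
      by (intro holomorphic_on_mult
          holomorphic_on_subset [OF holomorphic_kform_resolvent [OF S]]
          holomorphic_on_subset [OF holomorphic_on_csqrt_right_half_plane]) auto
    then show ?thesis
      by (rule holomorphic_transform) (simp add: F_app kform_scaleC_left)
  qed
  have op: "op_contour_integral \<gamma> (\<lambda>z x. csqrt z *\<^sub>C resolvent S z x) =
    integral {0..1} (\<lambda>t. cscale_op (vector_derivative \<gamma> (at t within {0..1})) (F (\<gamma> t)))"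
    unfolding op_contour_integral_def
  proof (rule integral_cong)
    fix t :: real assume "t \<in> {0..1}"
    then have "\<gamma> t \<in> ?\<Omega>" using \<gamma>(2) by (metis image_eqI path_image_def subsetD)
    then show "Blinfun (\<lambda>x. vector_derivative \<gamma> (at t within {0..1}) *\<^sub>C csqrt (\<gamma> t) *\<^sub>C resolvent S (\<gamma> t) x) =
        cscale_op (vector_derivative \<gamma> (at t within {0..1})) (F (\<gamma> t))"
      by (simp add: cscale_op_def [of "vector_derivative \<gamma> (at t within {0..1})"] F_app)
  qed
  show weak: "kform (contour_sqrt \<gamma> S x) y =
      1 / (2 * of_real pi * \<i>) * contour_integral \<gamma> (\<lambda>z. csqrt z * kform (resolvent S z x) y)" for x y
  proof -
    have "contour_integral \<gamma> (\<lambda>z. kform (blinfun_apply (F z) x) y) =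
        contour_integral \<gamma> (\<lambda>z. csqrt z * kform (resolvent S z x) y)"
      by (rule contour_integral_cong)
        (use \<gamma>(2) in \<open>auto simp: F_app kform_scaleC_left subset_iff\<close>)
    then show ?thesis
      unfolding contour_sqrt_def op kform_scaleC_left
        kform_operator_contour_integral [OF opn cont hol \<gamma>] by simp
  qed
  have "contour_sqrt \<gamma> S (c *\<^sub>C x) = c *\<^sub>C contour_sqrt \<gamma> S x" for c x
  proof (rule kform_nondegenerate)
    fix y
    have "contour_integral \<gamma> (\<lambda>z. csqrt z * kform (resolvent S z (c *\<^sub>C x)) y) =
        contour_integral \<gamma> (\<lambda>z. c * (csqrt z * kform (resolvent S z x) y))"
      using \<gamma>(2) by (intro contour_integral_cong)
        (auto simp: bounded_clinear_scaleC [OF bounded_clinear_resolvent [OF S]] kform_scaleC_left subset_iff)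
    also have "\<dots> = c * contour_integral \<gamma> (\<lambda>z. csqrt z * kform (resolvent S z x) y)"
    proof (rule contour_integral_lmul)
      show "(\<lambda>z. csqrt z * kform (resolvent S z x) y) contour_integrable_on \<gamma>"
        by (rule contour_integrable_holomorphic_simple [OF _ opn \<gamma>])
          (intro holomorphic_on_mult
            holomorphic_on_subset [OF holomorphic_kform_resolvent [OF S]]
            holomorphic_on_subset [OF holomorphic_on_csqrt_right_half_plane]; auto)
    qed
    finally show "kform (contour_sqrt \<gamma> S (c *\<^sub>C x)) y = kform (c *\<^sub>C contour_sqrt \<gamma> S x) y"
      by (simp add: weak kform_scaleC_left)
  qed
  moreover have "bounded_linear (contour_sqrt \<gamma> S)"
    unfolding contour_sqrt_def
    by (intro bounded_linear_compose [OF bounded_bilinear.bounded_linear_right [OF bounded_bilinear_scaleC]]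
        blinfun.bounded_linear_right)
  ultimately show "bounded_clinear (contour_sqrt \<gamma> S)"
    by (simp add: bounded_clinear_def)
qed

section \<open>The square root of an operator\<close>

text \<open>
  The inversion \<open>u = 1 / (z - a)\<close>, with \<open>a\<close> in the exceptional compact set, moves infinity to
  \<open>0\<close>. It carries \<open>\<gamma>\<close> to a loop winding \<open>-1\<close> times around \<open>0\<close> and \<open>0\<close> times
  around every other excluded point, so that Cauchy's integral formula at \<open>0\<close> applies.
\<close>

lemma contour_integral_residue_at_infinity:
  assumes K: "compact K" and hol: "r holomorphic_on - K"
    and lim: "((\<lambda>z. z * r z) \<longlongrightarrow> c) at_infinity"
    and \<gamma>: "valid_path \<gamma>" "pathfinish \<gamma> = pathstart \<gamma>" "path_image \<gamma> \<subseteq> - K"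
    and wind: "\<And>a. a \<in> K \<Longrightarrow> winding_number \<gamma> a = 1"
  shows "contour_integral \<gamma> r = 2 * of_real pi * \<i> * c"
proof -
  have "((\<lambda>z. z * r z * inverse z) \<longlongrightarrow> c * 0) at_infinity"
    by (rule tendsto_mult [OF lim tendsto_inverse_0])
  moreover have "\<forall>\<^sub>F z in at_infinity. z * r z * inverse z = r z"
    by (rule eventually_at_infinityI [of 1]) (force simp: field_simps)
  ultimately have r0: "(r \<longlongrightarrow> 0) at_infinity"
    by (auto simp: tendsto_cong)
  show ?thesis
  proof (cases "K = {}")
    case True
    \<comment> \<open>Then \<open>r\<close> is entire and tends to \<open>0\<close>, so both sides are \<open>0\<close>.\<close>
    then have r: "r z = 0" for z
      using Liouville_weak_0 [OF _ r0] hol by auto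
    then have "c = 0" 
      using lim tendsto_unique [OF trivial_limit_at_infinity _ tendsto_const] by simp
    moreover have "r = (\<lambda>z. 0)" using r by auto
    ultimately show ?thesis by simp
  next
    case False
    then obtain a where a: "a \<in> K" by blast
    define h where "h z = 1 / (z - a)" for z
    define D where "D = - h ` (K - {a})"
    define G where "G u = (if u = 0 then c else r (a + 1 / u) / u)" for u
    have deriv_h: "deriv h z = - (1 / (z - a)\<^sup>2)" if "z \<noteq> a" for z
      unfolding h_def using that
      by (intro DERIV_imp_deriv) (auto intro!: derivative_eq_intros simp: power2_eq_square)
    have an_h: "h analytic_on - {a}"
      unfolding h_def by (intro analytic_intros) auto
    have \<gamma>a: "path_image \<gamma> \<subseteq> - {a}" using \<gamma>(3) a by auto
    have subst: "contour_integral (h \<circ> \<gamma>) g = contour_integral \<gamma> (\<lambda>z. - (1 / (z - a)\<^sup>2) * g (h z))" for g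
      unfolding contour_integral_comp_analyticW [OF an_h \<gamma>(1) \<gamma>a]
    proof (rule contour_integral_cong [OF refl])
      fix z assume "z \<in> path_image \<gamma>"
      then have "z \<noteq> a" using \<gamma>a by auto
      then show "deriv h z * g (h z) = - (1 / (z - a)\<^sup>2) * g (h z)"
        by (simp add: deriv_h)
    qed
    have vp: "valid_path (h \<circ> \<gamma>)"
      using valid_path_compose_analytic [OF \<gamma>(1) an_h \<gamma>a] .
    have loop: "pathfinish (h \<circ> \<gamma>) = pathstart (h \<circ> \<gamma>)"
      using \<gamma>(2) by (simp add: pathfinish_compose pathstart_compose)
    have inD: "u \<in> D \<longleftrightarrow> u = 0 \<or> a + 1 / u \<notin> K" for u
    proof (cases "u = 0")
      case False
      define v where "v = a + 1 / u"
      have v: "v \<noteq> a" "h v = u" using False by (simp_all add: h_def v_def)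
      have "w = v" if "h w = u" for w
        using that False by (auto simp: h_def v_def)
      then have "u \<in> h ` (K - {a}) \<longleftrightarrow> v \<in> K" using v by blast
      with False show ?thesis by (simp add: D_def v_def)
    qed (auto simp: D_def h_def)
    have "open D"
    proof -
      obtain B where B: "B > 0" "\<And>z. z \<in> K \<Longrightarrow> norm (z - a) \<le> B"
        using bounded_subset_ballD [OF compact_imp_bounded [OF K], of a]
        by (force simp: dist_norm norm_minus_commute)
      have "u \<in> D" if "norm u < 1 / B" for u
      proof (cases "u = 0")
        case False
        then have "B < norm (1 / u)" using that B(1) by (simp add: norm_divide field_simps)
        then show ?thesis using B(2) [of "a + 1 / u"] by (auto simp: inD)
      qed (simp add: inD)
      then have "D = ball 0 (1 / B) \<union> (- {0} \<inter> (\<lambda>u. a + 1 / u) -` (- K))"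
        using B(1) by (auto simp: inD)
      moreover have "open (- {0} \<inter> (\<lambda>u::complex. a + 1 / u) -` (- K))"
        using compact_imp_closed [OF K]
        by (intro continuous_open_preimage continuous_intros) auto
      ultimately show ?thesis by auto
    qed
    have "G holomorphic_on D"
    proof -
      have "(\<lambda>u. r (a + 1 / u) / u) holomorphic_on D - {0}"
      proof (intro holomorphic_intros)
        have "(\<lambda>u. a + 1 / u) holomorphic_on D - {0}"
          by (intro holomorphic_intros) auto
        moreover have "(\<lambda>u. a + 1 / u) ` (D - {0}) \<subseteq> - K"
          by (auto simp: inD)
        ultimately show "(\<lambda>u. r (a + 1 / u)) holomorphic_on D - {0}"
          using holomorphic_on_compose_gen [OF _ hol, of "\<lambda>u. a + 1 / u"] by (simp add: o_def)
      qed auto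
      moreover have "((\<lambda>u. r (a + 1 / u) / u) \<longlongrightarrow> c) (at 0)"
      proof -
        have "((\<lambda>z. z * r z - a * r z) \<longlongrightarrow> c - a * 0) at_infinity"
          by (intro tendsto_intros lim r0)
        then have "((\<lambda>z. (z - a) * r z) \<longlongrightarrow> c) at_infinity"
          by (simp add: left_diff_distrib)
        moreover have "filterlim (\<lambda>u::complex. a + inverse u) at_infinity (at 0)"
          by (rule tendsto_add_filterlim_at_infinity [OF tendsto_const filterlim_inverse_at_infinity])
        ultimately have "((\<lambda>u. (a + inverse u - a) * r (a + inverse u)) \<longlongrightarrow> c) (at 0)"
          by (rule filterlim_compose)
        then show ?thesis by (simp add: field_simps)
      qed
      ultimately show ?thesis
        unfolding G_def by (intro removable_singularity \<open>open D\<close>)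
    qed
    moreover have "path_image (h \<circ> \<gamma>) \<subseteq> D - {0}"
      using \<gamma>(3) \<gamma>a by (auto simp: path_image_compose inD h_def)
    moreover have "winding_number (h \<circ> \<gamma>) u = 0" if u: "u \<notin> D" for u
    proof -
      obtain w where w: "w \<in> K" "w \<noteq> a" "u = 1 / (w - a)"
        using u unfolding D_def h_def by blast
      have w\<gamma>: "w \<notin> path_image \<gamma>" "a \<notin> path_image \<gamma>" using w \<gamma>(3) a by auto
      have "u \<notin> path_image (h \<circ> \<gamma>)"
        using w w\<gamma> by (auto simp: path_image_compose h_def)
      then have "winding_number (h \<circ> \<gamma>) u = 1 / (2 * pi * \<i>) * contour_integral (h \<circ> \<gamma>) (\<lambda>v. 1 / (v - u))"
        by (rule winding_number_valid_path [OF vp])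
      also have "contour_integral (h \<circ> \<gamma>) (\<lambda>v. 1 / (v - u)) =
          contour_integral \<gamma> (\<lambda>z. 1 / (z - w) - 1 / (z - a))"
        unfolding subst
      proof (rule contour_integral_cong [OF refl])
        fix z assume "z \<in> path_image \<gamma>"
        then have "z \<noteq> a" "z \<noteq> w" using w\<gamma> by auto
        have "h z - u = - ((z - w) / ((z - a) * (w - a)))"
          using diff_frac_eq [of "z - a" "w - a" 1 1] \<open>z \<noteq> a\<close> w(2)
          by (simp add: h_def w(3) minus_divide_left del: divide_minus_left)
        moreover have "1 / (z - w) - 1 / (z - a) = (w - a) / ((z - w) * (z - a))"
          using diff_frac_eq [of "z - w" "z - a" 1 1] \<open>z \<noteq> a\<close> \<open>z \<noteq> w\<close> by simp
        ultimately show "- (1 / (z - a)\<^sup>2) * (1 / (h z - u)) = 1 / (z - w) - 1 / (z - a)"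
          using \<open>z \<noteq> a\<close> by (simp only: divide_minus_right) (simp add: power2_eq_square mult.commute)
      qed
      also have "((\<lambda>z. 1 / (z - w) - 1 / (z - a)) has_contour_integral
          2 * pi * \<i> * winding_number \<gamma> w - 2 * pi * \<i> * winding_number \<gamma> a) \<gamma>"
        by (intro has_contour_integral_diff has_contour_integral_winding_number \<gamma> w\<gamma>)
      then have "contour_integral \<gamma> (\<lambda>z. 1 / (z - w) - 1 / (z - a)) = 0"
        using wind w a by (simp add: contour_integral_unique)
      finally show ?thesis by (simp add: o_def)
    qed
    ultimately have "((\<lambda>u. G u / (u - 0)) has_contour_integral
        2 * pi * \<i> * winding_number (h \<circ> \<gamma>) 0 * G 0) (h \<circ> \<gamma>)"
      by (intro Cauchy_integral_formula_global [OF \<open>open D\<close>] vp loop) (auto simp: inD)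
    moreover have "winding_number (h \<circ> \<gamma>) 0 = - 1"
    proof -
      have "0 \<notin> path_image (h \<circ> \<gamma>)"
        using \<gamma>a by (auto simp: path_image_compose h_def)
      then have "winding_number (h \<circ> \<gamma>) 0 = 1 / (2 * pi * \<i>) * contour_integral (h \<circ> \<gamma>) (\<lambda>v. 1 / (v - 0))"
        by (rule winding_number_valid_path [OF vp])
      also have "contour_integral (h \<circ> \<gamma>) (\<lambda>v. 1 / (v - 0)) = contour_integral \<gamma> (\<lambda>z. - (1 / (z - a)))"
        unfolding subst by (rule contour_integral_cong) (auto simp: h_def power2_eq_square)
      also have "((\<lambda>z. - (1 / (z - a))) has_contour_integral - (2 * pi * \<i> * winding_number \<gamma> a)) \<gamma>"
        by (intro has_contour_integral_neg has_contour_integral_winding_number) (use \<gamma> \<gamma>a in auto)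
      then have "contour_integral \<gamma> (\<lambda>z. - (1 / (z - a))) = - (2 * pi * \<i>)"
        using wind a by (simp add: contour_integral_unique)
      finally show ?thesis by (simp add: o_def)
    qed
    ultimately have "contour_integral (h \<circ> \<gamma>) (\<lambda>u. G u / u) = - (2 * pi * \<i> * c)"
      by (simp add: G_def contour_integral_unique)
    moreover have "contour_integral (h \<circ> \<gamma>) (\<lambda>u. G u / u) = contour_integral \<gamma> (\<lambda>z. - r z)"
      unfolding subst
    proof (rule contour_integral_cong [OF refl])
      fix z assume "z \<in> path_image \<gamma>"
      then have "z \<noteq> a" using \<gamma>a by auto
      then show "- (1 / (z - a)\<^sup>2) * (G (h z) / h z) = - r z"
        by (simp add: G_def h_def power2_eq_square)
    qed
    moreover have "contour_integral \<gamma> (\<lambda>z. - r z) = - contour_integral \<gamma> r"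
      by (intro contour_integral_neg contour_integrable_holomorphic_simple [OF hol]
          \<gamma> open_Compl compact_imp_closed K)
    ultimately show ?thesis by simp
  qed
qed

text \<open>A polynomial loop has a continuous derivative, which permits differentiation under the integral
  sign along it.\<close>

lemma polynomial_loop_same_integrals:
  assumes "open \<Omega>" "valid_path \<gamma>" "pathfinish \<gamma> = pathstart \<gamma>" "path_image \<gamma> \<subseteq> \<Omega>"
  obtains p where "polynomial_function p" "pathfinish p = pathstart p" "path_image p \<subseteq> \<Omega>"
    "\<And>f. f holomorphic_on \<Omega> \<Longrightarrow> contour_integral p f = contour_integral \<gamma> f"
proof -
  have "path \<gamma>" using assms(2) by (rule valid_path_imp_path)
  obtain d where d: "d > 0" "\<And>g h. valid_path g \<Longrightarrow> valid_path h \<Longrightarrow>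
      \<forall>t\<in>{0..1}. norm (g t - \<gamma> t) < d \<and> norm (h t - \<gamma> t) < d \<Longrightarrow>
      pathstart h = pathstart g \<and> pathfinish h = pathfinish g \<Longrightarrow>
      path_image h \<subseteq> \<Omega> \<and> (\<forall>f. f holomorphic_on \<Omega> \<longrightarrow> contour_integral h f = contour_integral g f)"
    using contour_integral_nearby_ends [OF assms(1) \<open>path \<gamma>\<close> assms(4)] by metis
  obtain p where p: "polynomial_function p" "pathstart p = pathstart \<gamma>" "pathfinish p = pathfinish \<gamma>"
      "\<And>t. t \<in> {0..1} \<Longrightarrow> norm (p t - \<gamma> t) < d"
    using path_approx_polynomial_function [OF \<open>path \<gamma>\<close> d(1)] by blast
  have "path_image p \<subseteq> \<Omega> \<and> (\<forall>f. f holomorphic_on \<Omega> \<longrightarrow> contour_integral p f = contour_integral \<gamma> f)"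
    using p d(1) by (intro d(2) assms(2) valid_path_polynomial_function) auto
  with p assms(3) that show ?thesis by auto
qed

lemma csqrt_add_csqrt_nonzero:
  assumes "Re z > 0" "Re w > 0"
  shows "csqrt z + csqrt w \<noteq> 0"
proof -
  have "Re (csqrt z + csqrt w) > 0"
    using assms Re_pos_imp_csqrt_Re_pos by (simp add: add_pos_pos del: csqrt.simps)
  then show ?thesis by (metis less_irrefl zero_complex.sel(1))
qed

lemmas continuous_on_csqrt_right_half_plane =
  holomorphic_on_imp_continuous_on [OF holomorphic_on_csqrt_right_half_plane]

lemma right_half_plane_not_nonpos_Reals: "Re z > 0 \<Longrightarrow> z \<notin> \<real>\<^sub>\<le>\<^sub>0"
  by (auto simp: complex_nonpos_Reals_iff)

lemma holomorphic_sqrt_kernel_integral: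
  assumes p: "polynomial_function p" and im: "path_image p \<subseteq> {z. Re z > 0}"
    and r: "continuous_on (path_image p) r"
  shows "(\<lambda>w. contour_integral p (\<lambda>z. r z / (csqrt z + csqrt w))) holomorphic_on {w. Re w > 0}"
proof -
  obtain p' where p': "polynomial_function p'" "\<And>t. (p has_vector_derivative p' t) (at t)"
    using has_vector_derivative_polynomial_function [OF p] by blast
  have pt: "p t \<in> path_image p" "Re (p t) > 0" if "t \<in> {0..1}" for t
    using that im unfolding path_image_def by blast+
  have cp: "continuous_on {0..1} p" "continuous_on {0..1} p'"
    using p p'(1) by (auto intro: continuous_on_polymonial_function)
  have crp: "continuous_on {0..1} (\<lambda>t. r (p t))"
    by (rule continuous_on_compose2 [OF r cp(1)]) (use pt in auto)
  have csp: "continuous_on {0..1} (\<lambda>t. csqrt (p t))"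
    by (rule continuous_on_compose2 [OF continuous_on_csqrt_right_half_plane cp(1)]) (use pt in auto)
  let ?U = "{w. Re w > 0}"
  let ?f = "\<lambda>w t. r (p t) / (csqrt (p t) + csqrt w) * p' t"
  let ?f' = "\<lambda>w t. - (r (p t) * p' t / (csqrt (p t) + csqrt w)\<^sup>2 * (1 / (2 * csqrt w)))"
  have "(\<lambda>w. integral (cbox 0 1) (?f w)) holomorphic_on ?U"
  proof (rule leibniz_rule_holomorphic [where fx = ?f'])
    fix w t assume w: "w \<in> ?U" and t: "t \<in> cbox (0::real) 1"
    have nz: "csqrt (p t) + csqrt w \<noteq> 0"
      using w pt(2) t by (intro csqrt_add_csqrt_nonzero) auto
    have nr: "w \<notin> \<real>\<^sub>\<le>\<^sub>0" using w right_half_plane_not_nonpos_Reals by blast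
    show "((\<lambda>w. ?f w t) has_field_derivative ?f' w t) (at w within ?U)"
    proof -
      have *: "((\<lambda>v. A / (B + v) * C) has_field_derivative - (A * C / (B + v)\<^sup>2)) (at v)"
        if "B + v \<noteq> 0" for A B C v :: complex
        using that by (auto intro!: derivative_eq_intros simp: power2_eq_square)
      have "((\<lambda>w. ?f w t) has_field_derivative ?f' w t) (at w)"
        using DERIV_chain2 [OF * [OF nz] has_field_derivative_csqrt [OF nr], of "r (p t)" "p' t"]
        by (simp add: field_simps)
      then show ?thesis by (rule has_field_derivative_at_within)
    qed
  next
    fix w assume w: "w \<in> ?U"
    have "continuous_on {0..1} (?f w)"
      using w pt(2) csqrt_add_csqrt_nonzero by (intro continuous_intros crp csp cp) auto
    then show "?f w integrable_on cbox 0 1"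
      by (simp add: integrable_continuous_interval)
  next
    have fst: "continuous_on (?U \<times> {0..1}) (\<lambda>x. csqrt (fst x))"
      by (rule continuous_on_compose2 [OF continuous_on_csqrt_right_half_plane])
        (auto intro: continuous_intros)
    have snd: "continuous_on (?U \<times> {0..1}) (\<lambda>x. g (snd x))"
      if "continuous_on {0..1} g" for g :: "real \<Rightarrow> complex"
      by (rule continuous_on_compose2 [OF that]) (auto intro: continuous_intros)
    have "csqrt (p (snd x)) + csqrt (fst x) \<noteq> 0" "csqrt (fst x) \<noteq> 0" if "x \<in> ?U \<times> {0..1}" for x
      using that pt(2) csqrt_add_csqrt_nonzero [of "p (snd x)" "fst x"] by auto
    then have "continuous_on (?U \<times> {0..1}) (\<lambda>x. ?f' (fst x) (snd x))"
      by (intro continuous_on_minus continuous_on_mult continuous_on_divide continuous_on_power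
          continuous_on_add continuous_on_const fst snd [OF crp] snd [OF csp] snd [OF cp(2)]) auto
    then show "continuous_on (?U \<times> cbox 0 1) (\<lambda>(w, t). ?f' w t)"
      by (simp add: case_prod_beta)
  qed (rule convex_halfspace_Re_gt)
  moreover have "contour_integral p (\<lambda>z. r z / (csqrt z + csqrt w)) = integral (cbox 0 1) (?f w)" for w
    unfolding contour_integral_integral using vector_derivative_at [OF p'(2)] by simp
  ultimately show ?thesis by simp
qed

text \<open>
  Functional calculus for one function. All integrals are taken in the weak sense,
  \<open>[\<Phi>(g) x, y] = 1/(2\<pi>i) \<integral> g(z) [R(z) x, y] dz\<close>. The divided difference of the square
  root is \<open>(\<surd>z - \<surd>w) / (z - w) = 1 / (\<surd>z + \<surd>w)\<close>, which is holomorphic in both variables on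
  the right half-plane. Multiplying the resolvent identity by \<open>\<surd>z - \<surd>w\<close> therefore gives
  \<open>R(w) Q = \<surd>w R(w) - k(w)\<close> with \<open>k\<close> holomorphic on the half-plane, and by Cauchy's theorem \<open>k\<close>
  disappears when this is integrated against \<open>1\<close> or \<open>\<surd>w\<close>. Both integrations run over the same contour.
\<close>

locale sqrt_contour =
  fixes S :: "'a::krein_space \<Rightarrow> 'a" and \<gamma> :: "real \<Rightarrow> complex"
  assumes S: "bounded_clinear S"
    and sa: "kform (S x) y = kform x (S y)"
    and \<gamma>: "valid_path \<gamma>" "pathfinish \<gamma> = pathstart \<gamma>"
    and im: "path_image \<gamma> \<subseteq> {z. Re z > 0} - op_spectrum S"
    and bounded_spectrum: "bounded (op_spectrum S)"
    and wind: "z \<in> op_spectrum S \<Longrightarrow> winding_number \<gamma> z = 1"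
begin

abbreviation \<Omega> :: "complex set" where "\<Omega> \<equiv> {z. Re z > 0} - op_spectrum S"

abbreviation Q :: "'a \<Rightarrow> 'a" where "Q \<equiv> contour_sqrt \<gamma> S"

abbreviation R :: "complex \<Rightarrow> 'a \<Rightarrow> 'a" where "R \<equiv> resolvent S"

lemma open_\<Omega>: "open \<Omega>"
  by (intro open_Diff open_halfspace_Re_gt closed_op_spectrum S)

text \<open>At infinity, \<open>z R(z) = 1 + S R(z)\<close> tends to \<open>1\<close>.\<close>

lemma contour_integral_kform_resolvent:
  "contour_integral \<gamma> (\<lambda>z. kform (R z x) y) = 2 * of_real pi * \<i> * kform x y"
proof (rule contour_integral_residue_at_infinity [where K = "op_spectrum S"])
  show "compact (op_spectrum S)"
    using closed_op_spectrum [OF S] bounded_spectrum by (simp add: compact_eq_bounded_closed)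
  show "(\<lambda>z. kform (R z x) y) holomorphic_on - op_spectrum S"
    by (rule holomorphic_kform_resolvent [OF S])
  obtain B where B: "\<And>z. z \<in> op_spectrum S \<Longrightarrow> cmod z \<le> B"
    using bounded_spectrum by (auto simp: bounded_iff)
  have "((\<lambda>z. kform x y + kform (R z x) (S y)) \<longlongrightarrow> kform x y + kform 0 (S y)) at_infinity"
    by (intro tendsto_intros bounded_linear.tendsto [OF bounded_linear_kform_left]
        resolvent_tendsto_0 S bounded_spectrum)
  moreover have "\<forall>\<^sub>F z in at_infinity. kform x y + kform (R z x) (S y) = z * kform (R z x) y"
  proof (rule eventually_at_infinityI [of "B + 1"])
    fix z assume "B + 1 \<le> cmod z"
    then have z: "z \<notin> op_spectrum S" using B by fastforce
    show "kform x y + kform (R z x) (S y) = z * kform (R z x) y"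
      by (simp add: op_resolvent [OF S z] kform_diff_left kform_scaleC_left flip: sa)
  qed
  ultimately show "((\<lambda>z. z * kform (R z x) y) \<longlongrightarrow> kform x y) at_infinity"
    by (simp add: tendsto_cong)
qed (use \<gamma> im wind in auto)

text \<open>
  A polynomial replacement for \<open>\<gamma>\<close>, fixed once so that all later integrals refer to the same path.
\<close>

definition loop :: "real \<Rightarrow> complex" where
  "loop = (SOME p. polynomial_function p \<and> pathfinish p = pathstart p \<and> path_image p \<subseteq> \<Omega> \<and>
    (\<forall>f. f holomorphic_on \<Omega> \<longrightarrow> contour_integral p f = contour_integral \<gamma> f))"

lemma
  shows polynomial_loop: "polynomial_function loop"
    and closed_loop: "pathfinish loop = pathstart loop"
    and path_image_loop: "path_image loop \<subseteq> \<Omega>"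
    and contour_integral_loop: "f holomorphic_on \<Omega> \<Longrightarrow> contour_integral loop f = contour_integral \<gamma> f"
proof -
  have "\<exists>p. polynomial_function p \<and> pathfinish p = pathstart p \<and> path_image p \<subseteq> \<Omega> \<and>
    (\<forall>f. f holomorphic_on \<Omega> \<longrightarrow> contour_integral p f = contour_integral \<gamma> f)"
    using polynomial_loop_same_integrals [OF open_\<Omega> \<gamma> im] by metis
  from someI_ex [OF this, folded loop_def]
  show "polynomial_function loop" "pathfinish loop = pathstart loop" "path_image loop \<subseteq> \<Omega>"
    "f holomorphic_on \<Omega> \<Longrightarrow> contour_integral loop f = contour_integral \<gamma> f"
    by blast+
qed

lemma valid_loop: "valid_path loop"
  by (rule valid_path_polynomial_function [OF polynomial_loop])

lemma loop_integrable: "f holomorphic_on \<Omega> \<Longrightarrow> f contour_integrable_on loop"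
  by (rule contour_integrable_holomorphic_simple [OF _ open_\<Omega> valid_loop path_image_loop])

lemma loop_integral_half_plane: "f holomorphic_on {z. Re z > 0} \<Longrightarrow> contour_integral loop f = 0"
  using path_image_loop
  by (intro contour_integral_unique
      Cauchy_theorem_convex_simple [OF _ convex_halfspace_Re_gt valid_loop _ closed_loop]) auto

lemma holomorphic_resolvent [holomorphic_intros]: "(\<lambda>z. kform (R z x) y) holomorphic_on \<Omega>"
  by (rule holomorphic_on_subset [OF holomorphic_kform_resolvent [OF S]]) auto

lemma holomorphic_csqrt [holomorphic_intros]: "csqrt holomorphic_on \<Omega>"
  by (rule holomorphic_on_subset [OF holomorphic_on_csqrt_right_half_plane]) auto

lemma holomorphic_sqrt_kernel:
  "Re w > 0 \<Longrightarrow> (\<lambda>z. 1 / (csqrt z + csqrt w)) holomorphic_on {z. Re z > 0}"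
  by (intro holomorphic_intros holomorphic_on_csqrt_right_half_plane)
    (simp add: csqrt_add_csqrt_nonzero del: csqrt.simps)

lemma loop_integral_resolvent:
  "contour_integral loop (\<lambda>z. kform (R z x) y) = 2 * of_real pi * \<i> * kform x y"
  by (simp add: contour_integral_loop contour_integral_kform_resolvent holomorphic_resolvent)

lemma kform_sqrt:
  "2 * of_real pi * \<i> * kform (Q x) y = contour_integral loop (\<lambda>z. csqrt z * kform (R z x) y)"
  by (simp add: contour_integral_loop holomorphic_intros kform_contour_sqrt [OF S \<gamma>(1) im])

definition remainder :: "'a \<Rightarrow> 'a \<Rightarrow> complex \<Rightarrow> complex" where
  "remainder x y w = contour_integral loop (\<lambda>z. kform (R z x) y / (csqrt z + csqrt w))"

lemma holomorphic_remainder: "remainder x y holomorphic_on {w. Re w > 0}"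
  unfolding remainder_def
proof (rule holomorphic_sqrt_kernel_integral [OF polynomial_loop])
  show "continuous_on (path_image loop) (\<lambda>z. kform (R z x) y)"
    using holomorphic_on_imp_continuous_on [OF holomorphic_resolvent] path_image_loop
    by (rule continuous_on_subset)
qed (use path_image_loop in auto)

lemma resolvent_sqrt:
  assumes w: "w \<in> \<Omega>"
  shows "2 * of_real pi * \<i> * kform (R w (Q x)) y =
    2 * of_real pi * \<i> * (csqrt w * kform (R w x) y) - remainder x y w"
proof -
  let ?y = "R (cnj w) y"
  let ?h = "\<lambda>z. 1 / (csqrt z + csqrt w)"
  have nz: "csqrt z + csqrt w \<noteq> 0" if "z \<in> \<Omega>" for z
    using that w by (simp add: csqrt_add_csqrt_nonzero del: csqrt.simps)
  have adj: "kform u ?y = kform (R w u) y" for u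
    using kform_resolvent [OF S sa, of w u y] w by simp
  have hol_h: "?h holomorphic_on \<Omega>"
    using holomorphic_sqrt_kernel [of w] w by (auto intro: holomorphic_on_subset)
  have ints: "(\<lambda>z. csqrt w * kform (R z x) ?y) contour_integrable_on loop"
    "(\<lambda>z. kform (R z x) y / (csqrt z + csqrt w)) contour_integrable_on loop"
    "(\<lambda>z. kform (R w x) y * ?h z) contour_integrable_on loop"
    using nz by (auto intro!: loop_integrable holomorphic_intros hol_h)
  have "2 * of_real pi * \<i> * kform (R w (Q x)) y
      = contour_integral loop (\<lambda>z. csqrt z * kform (R z x) ?y)"
    by (simp only: kform_sqrt flip: adj)
  also have "\<dots> = contour_integral loop (\<lambda>z. csqrt w * kform (R z x) ?y
      - kform (R z x) y / (csqrt z + csqrt w) + kform (R w x) y * ?h z)"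
  proof (rule contour_integral_cong [OF refl])
    fix z assume "z \<in> path_image loop"
    then have z: "z \<in> \<Omega>" using path_image_loop by blast
    let ?s = "csqrt z + csqrt w"
    have "kform (R z x) y - kform (R w x) y = (w - z) * kform (R z x) ?y"
      using resolvent_identity [OF S, of z w x] z w
      by (simp add: adj flip: kform_diff_left kform_scaleC_left)
    also have "w - z = ?s * (csqrt w - csqrt z)"
      using power2_csqrt [of z] power2_csqrt [of w] by (simp add: algebra_simps power2_eq_square)
    finally have "(kform (R z x) y - kform (R w x) y) / ?s = (csqrt w - csqrt z) * kform (R z x) ?y"
      using nz [OF z] by simp
    then show "csqrt z * kform (R z x) ?y = csqrt w * kform (R z x) ?y
        - kform (R z x) y / ?s + kform (R w x) y * ?h z"
      by (simp add: diff_divide_distrib algebra_simps)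
  qed
  also have "\<dots> = csqrt w * contour_integral loop (\<lambda>z. kform (R z x) ?y)
      - remainder x y w + kform (R w x) y * contour_integral loop ?h"
    unfolding contour_integral_add [OF contour_integrable_diff [OF ints(1,2)] ints(3)]
      contour_integral_diff [OF ints(1,2)] remainder_def
    by (simp only: contour_integral_lmul loop_integrable holomorphic_resolvent hol_h)
  also have "contour_integral loop ?h = 0"
    using w by (intro loop_integral_half_plane holomorphic_sqrt_kernel) auto
  also have "contour_integral loop (\<lambda>z. kform (R z x) ?y) = 2 * of_real pi * \<i> * kform (R w x) y"
    unfolding loop_integral_resolvent by (simp only: adj)
  finally show ?thesis by (simp add: mult_ac del: csqrt.simps)
qed

text \<open>
  \<open>Q\<^sup>2 = 1/(2\<pi>i) \<integral> \<surd>w R(w) Q dw = 1/(2\<pi>i) \<integral> (w R(w) - \<surd>w k(w)) dw\<close>, and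
  \<open>w R(w) = 1 + R(w) S\<close>; of the three integrals the first and the third vanish.
\<close>

theorem sqrt_square: "Q (Q x) = S x"
proof (rule kform_nondegenerate)
  fix y
  let ?c = "2 * of_real pi * \<i>"
  have "?c * (?c * kform (Q (Q x)) y) = contour_integral loop (\<lambda>w. ?c * (csqrt w * kform (R w (Q x)) y))"
    by (simp only: kform_sqrt)
      (intro contour_integral_lmul [symmetric] loop_integrable holomorphic_intros)
  also have "\<dots> = contour_integral loop (\<lambda>w. ?c * kform x y
      + ?c * kform (R w x) (S y) - csqrt w * remainder x y w)"
  proof (rule contour_integral_cong [OF refl])
    fix w assume "w \<in> path_image loop"
    then have w: "w \<in> \<Omega>" using path_image_loop by blast
    have "w * kform (R w x) y = kform x y + kform (R w x) (S y)"
      using op_resolvent [OF S, of w x] w by (simp add: kform_diff_left kform_scaleC_left flip: sa)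
    then have "csqrt w * (csqrt w * kform (R w x) y) = kform x y + kform (R w x) (S y)"
      using power2_csqrt [of w] by (simp add: power2_eq_square flip: mult.assoc)
    moreover have "?c * (csqrt w * kform (R w (Q x)) y) = csqrt w * (?c * kform (R w (Q x)) y)"
      by (simp only: mult_ac)
    moreover have "\<dots> = ?c * (csqrt w * (csqrt w * kform (R w x) y)) - csqrt w * remainder x y w"
      unfolding resolvent_sqrt [OF w] by (simp only: right_diff_distrib mult_ac)
    ultimately show "?c * (csqrt w * kform (R w (Q x)) y) =
        ?c * kform x y + ?c * kform (R w x) (S y) - csqrt w * remainder x y w"
      by (simp only: distrib_left)
  qed
  also have "\<dots> = contour_integral loop (\<lambda>w. ?c * kform x y)
      + ?c * contour_integral loop (\<lambda>w. kform (R w x) (S y))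
      - contour_integral loop (\<lambda>w. csqrt w * remainder x y w)"
    by (simp add: contour_integral_add contour_integral_diff contour_integrable_add
        contour_integral_lmul loop_integrable holomorphic_intros
        holomorphic_on_subset [OF holomorphic_remainder])
  also have "contour_integral loop (\<lambda>w. ?c * kform x y) = 0"
    by (intro loop_integral_half_plane holomorphic_intros)
  also have "contour_integral loop (\<lambda>w. csqrt w * remainder x y w) = 0"
    by (intro loop_integral_half_plane holomorphic_intros holomorphic_remainder
        holomorphic_on_csqrt_right_half_plane)
  finally have "?c * (?c * kform (Q (Q x)) y) = ?c * (?c * kform (S x) y)"
    by (simp add: loop_integral_resolvent sa)
  then show "kform (Q (Q x)) y = kform (S x) y" by simp
qed

text \<open>
  As \<open>R(w)\<^sup>+ = R(cnj w)\<close>, the adjoint of \<open>R(cnj w) Q\<close> is \<open>Q\<^sup>+ R(w)\<close>, so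
  \<open>Q\<^sup>+ = 1/(2\<pi>i) \<integral> Q\<^sup>+ R(w) dw = 1/(2\<pi>i) \<integral> (\<surd>w R(w) - k(cnj w)\<^sup>+) dw\<close>. The last term is
  again holomorphic in \<open>w\<close>, so what remains is the integral for \<open>Q\<close>.
\<close>

theorem sqrt_selfadjoint: "kform (Q x) y = kform x (Q y)"
proof -
  let ?c = "2 * of_real pi * \<i>"
  let ?K = "\<lambda>w. (cnj \<circ> remainder y x \<circ> cnj) w"
  have holK: "?K holomorphic_on {w. Re w > 0}"
    by (rule holomorphic_on_compose_cnj_cnj)
      (auto intro!: holomorphic_on_subset [OF holomorphic_remainder] open_halfspace_Re_gt)
  have "?c * (?c * kform x (Q y)) = ?c * contour_integral loop (\<lambda>w. kform (R w x) (Q y))"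
    by (simp only: loop_integral_resolvent)
  also have "\<dots> = contour_integral loop (\<lambda>w. ?c * kform (R w x) (Q y))"
    by (intro contour_integral_lmul [symmetric] loop_integrable holomorphic_intros)
  also have "\<dots> = contour_integral loop (\<lambda>w. ?c * (csqrt w * kform (R w x) y) + ?K w)"
  proof (rule contour_integral_cong [OF refl])
    fix w assume "w \<in> path_image loop"
    then have w: "w \<in> \<Omega>" using path_image_loop by blast
    have cw: "cnj w \<in> \<Omega>" using w op_spectrum_cnj [OF S sa, of w] by auto
    have adj: "kform (R w x) u = cnj (kform (R (cnj w) u) x)" for u
      using kform_resolvent [OF S sa, of w x u] w by (metis DiffD2 kform_hermitian)
    have "csqrt (cnj w) = cnj (csqrt w)"
      using w right_half_plane_not_nonpos_Reals [of w] by (simp add: cnj_csqrt)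
    then have "cnj (?c * kform (R (cnj w) (Q y)) x) =
        cnj ?c * (csqrt w * cnj (kform (R (cnj w) y) x)) - ?K w"
      unfolding resolvent_sqrt [OF cw] by (simp del: csqrt.simps)
    then show "?c * kform (R w x) (Q y) = ?c * (csqrt w * kform (R w x) y) + ?K w"
      by (simp add: adj algebra_simps del: csqrt.simps)
  qed
  also have "\<dots> = ?c * contour_integral loop (\<lambda>w. csqrt w * kform (R w x) y) + contour_integral loop ?K"
    by (simp only: contour_integral_add contour_integral_lmul loop_integrable holomorphic_intros
        holomorphic_on_subset [OF holK, of \<Omega>] Diff_subset)
  also have "contour_integral loop ?K = 0"
    by (rule loop_integral_half_plane [OF holK])
  finally have "?c * (?c * kform x (Q y)) = ?c * (?c * kform (Q x) y)"
    by (simp add: kform_sqrt)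
  then show ?thesis by simp
qed

end

section \<open>Bessel families and the frame operator\<close>

definition bessel_bound :: "'i set \<Rightarrow> ('i \<Rightarrow> 'a::krein_space) \<Rightarrow> real \<Rightarrow> bool" where
  "bessel_bound I f \<beta> \<longleftrightarrow> \<beta> > 0 \<and> (\<forall>h. (\<lambda>i. (cmod (kform h (f i)))\<^sup>2) summable_on I \<and>
     (\<Sum>\<^sub>\<infinity>i\<in>I. (cmod (kform h (f i)))\<^sup>2) \<le> \<beta> * (norm h)\<^sup>2)"

text \<open>
  Replacing the Hilbert inner product by the Krein form substitutes \<open>fund_sym h\<close> for \<open>h\<close>, a
  bijection that preserves the norm.
\<close>

lemma bessel_family_iff: "bessel_family I f \<longleftrightarrow> (\<exists>\<beta>. bessel_bound I f \<beta>)"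
proof -
  have "(\<forall>h. P (fund_sym h) (norm h)) \<longleftrightarrow> (\<forall>h. P h (norm h))" for P :: "'b::krein_space \<Rightarrow> real \<Rightarrow> bool"
    by (metis fund_sym_fund_sym norm_fund_sym)
  from this [of "\<lambda>h n. (\<lambda>i. (cmod (kform h (f i)))\<^sup>2) summable_on I \<and>
      (\<Sum>\<^sub>\<infinity>i\<in>I. (cmod (kform h (f i)))\<^sup>2) \<le> \<beta> * n\<^sup>2" for \<beta>]
  show ?thesis
    unfolding bessel_family_def bessel_bound_def hinner_eq_kform_left by blast
qed

definition frame_energy :: "'i set \<Rightarrow> ('i \<Rightarrow> 'a::krein_space) \<Rightarrow> 'a \<Rightarrow> real" where
  "frame_energy I f y = (\<Sum>\<^sub>\<infinity>i\<in>I. (cmod (kform y (f i)))\<^sup>2)"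

lemma index_Un: "index_plus I f \<union> index_minus I f = I"
  and index_Int: "index_plus I f \<inter> index_minus I f = {}"
  and index_plus_subset: "index_plus I f \<subseteq> I"
  and index_minus_subset: "index_minus I f \<subseteq> I"
  by (auto simp: index_plus_def index_minus_def)

lemma infsum_index_split:
  fixes g :: "'i \<Rightarrow> 'b::banach"
  assumes "g summable_on I"
  shows "infsum g I = infsum g (index_plus I f) + infsum g (index_minus I f)"
  using infsum_Un_disjoint [OF summable_on_subset_banach [OF assms index_plus_subset [of I f]]
      summable_on_subset_banach [OF assms index_minus_subset [of I f]] index_Int]
  by (simp add: index_Un)

lemma ell2_form_hermitian: "ell2_form I f y x = cnj (ell2_form I f x y)"
proof -
  have "(\<Sum>\<^sub>\<infinity>i\<in>K. y i * cnj (x i)) = cnj (\<Sum>\<^sub>\<infinity>i\<in>K. x i * cnj (y i))" for K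
    by (simp add: mult.commute flip: infsum_cnj)
  then show ?thesis by (simp add: ell2_form_def)
qed

lemma ell2_unit: "i \<in> I \<Longrightarrow> (\<lambda>j. if j = i then 1 else 0) \<in> ell2 I"
proof -
  have "(\<lambda>j. (cmod (if j = i then 1 else 0))\<^sup>2) summable_on I \<longleftrightarrow>
      (\<lambda>j. (cmod (if j = i then 1 else 0))\<^sup>2) summable_on (I \<inter> {i})"
    by (rule summable_on_cong_neutral) auto
  then show "i \<in> I \<Longrightarrow> ?thesis" by (auto simp: ell2_def)
qed

lemma infsum_unit:
  fixes g :: "'i \<Rightarrow> 'b::{topological_comm_monoid_add, t2_space}"
  assumes "\<And>j. j \<noteq> i \<Longrightarrow> g j = 0"
  shows "infsum g K = (if i \<in> K then g i else 0)"
proof -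
  have "infsum g K = infsum g (K \<inter> {i})"
    by (rule infsum_cong_neutral) (use assms in auto)
  then show ?thesis by auto
qed

lemma synthesis_plus_eq: "synthesis_plus I f x = (\<Sum>\<^sub>\<infinity>i\<in>index_plus I f. x i *\<^sub>C f i)"
  unfolding synthesis_plus_def synthesis_def coord_proj_def o_def
  by (rule infsum_cong_neutral) (auto simp: index_plus_def)

lemma synthesis_minus_eq: "synthesis_minus I f x = (\<Sum>\<^sub>\<infinity>i\<in>index_minus I f. x i *\<^sub>C f i)"
  unfolding synthesis_minus_def synthesis_def coord_proj_def o_def
  by (rule infsum_cong_neutral) (auto simp: index_minus_def)

lemma synthesis_unit: "i \<in> I \<Longrightarrow> synthesis I f (\<lambda>j. if j = i then 1 else 0) = f i"
  unfolding synthesis_def by (subst infsum_unit [where i = i]) auto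

lemma vector_in_synthesis_plus: "i \<in> index_plus I f \<Longrightarrow> f i \<in> synthesis_plus I f ` ell2 I"
  by (rule image_eqI [OF _ ell2_unit [of i]])
    (auto simp: synthesis_plus_eq infsum_unit [where i = i] index_plus_def)

lemma vector_in_synthesis_minus: "i \<in> index_minus I f \<Longrightarrow> f i \<in> synthesis_minus I f ` ell2 I"
  by (rule image_eqI [OF _ ell2_unit [of i]])
    (auto simp: synthesis_minus_eq infsum_unit [where i = i] index_minus_def)

text \<open>The value of the Krein adjoint of the synthesis operator.\<close>

definition signed_coefficients ::
    "'i set \<Rightarrow> ('i \<Rightarrow> 'a::krein_space) \<Rightarrow> 'a \<Rightarrow> 'i \<Rightarrow> complex" where
  "signed_coefficients I f y i =
     (if i \<in> index_plus I f then kform y (f i) else if i \<in> index_minus I f then - kform y (f i) else 0)"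

lemma norm_signed_coefficients: "i \<in> I \<Longrightarrow> cmod (signed_coefficients I f y i) = cmod (kform y (f i))"
  by (auto simp: signed_coefficients_def index_plus_def index_minus_def)

lemma infsum_signed_coefficients:
  shows "(\<Sum>\<^sub>\<infinity>i\<in>index_plus I f. x i * cnj (signed_coefficients I f y i)) =
      (\<Sum>\<^sub>\<infinity>i\<in>index_plus I f. x i * kform (f i) y)"
    and "(\<Sum>\<^sub>\<infinity>i\<in>index_minus I f. x i * cnj (signed_coefficients I f y i)) =
      - (\<Sum>\<^sub>\<infinity>i\<in>index_minus I f. x i * kform (f i) y)"
proof -
  show "(\<Sum>\<^sub>\<infinity>i\<in>index_plus I f. x i * cnj (signed_coefficients I f y i)) =
      (\<Sum>\<^sub>\<infinity>i\<in>index_plus I f. x i * kform (f i) y)"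
    by (rule infsum_cong) (simp add: signed_coefficients_def flip: kform_hermitian)
  have "(\<Sum>\<^sub>\<infinity>i\<in>index_minus I f. x i * cnj (signed_coefficients I f y i)) =
      (\<Sum>\<^sub>\<infinity>i\<in>index_minus I f. - (x i * kform (f i) y))"
    using index_Int [of I f]
    by (intro infsum_cong) (auto simp: signed_coefficients_def simp flip: kform_hermitian)
  then show "(\<Sum>\<^sub>\<infinity>i\<in>index_minus I f. x i * cnj (signed_coefficients I f y i)) =
      - (\<Sum>\<^sub>\<infinity>i\<in>index_minus I f. x i * kform (f i) y)"
    by (simp add: infsum_uminus)
qed

context
  fixes I :: "'i set" and f :: "'i \<Rightarrow> 'a::krein_space" and \<beta> :: real
  assumes bessel: "bessel_bound I f \<beta>"
begin

lemma bessel_pos: "\<beta> > 0"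
  and summable_coefficients: "(\<lambda>i. (cmod (kform y (f i)))\<^sup>2) summable_on I"
  and frame_energy_le: "frame_energy I f y \<le> \<beta> * (norm y)\<^sup>2"
  using bessel by (auto simp: bessel_bound_def frame_energy_def)

text \<open>The finite form of the statement that the synthesis operator is the adjoint of the bounded
  analysis operator.\<close>

lemma norm_finite_synthesis_le:
  assumes "finite F" "F \<subseteq> I"
  shows "(norm (\<Sum>i\<in>F. x i *\<^sub>C f i))\<^sup>2 \<le> \<beta> * (\<Sum>i\<in>F. (cmod (x i))\<^sup>2)"
proof -
  let ?u = "\<Sum>i\<in>F. x i *\<^sub>C f i"
  let ?v = "fund_sym ?u"
  define X where "X = L2_set (\<lambda>i. cmod (x i)) F"
  have "complex_of_real ((norm ?u)\<^sup>2) = (\<Sum>i\<in>F. x i * kform (f i) ?v)"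
    unfolding kform_fund_sym_self [symmetric] by (simp add: kform_sum_left kform_scaleC_left)
  then have "(norm ?u)\<^sup>2 = cmod (\<Sum>i\<in>F. x i * kform (f i) ?v)"
    by (metis norm_of_real abs_power2)
  also have "\<dots> \<le> (\<Sum>i\<in>F. \<bar>cmod (x i)\<bar> * \<bar>cmod (kform ?v (f i))\<bar>)"
    by (rule sum_norm_le) (simp add: norm_mult kform_hermitian [of _ ?v])
  also have "\<dots> \<le> X * L2_set (\<lambda>i. cmod (kform ?v (f i))) F"
    unfolding X_def by (rule L2_set_mult_ineq)
  also have "\<dots> \<le> X * (sqrt \<beta> * norm ?u)"
  proof (intro mult_left_mono)
    have "(\<Sum>i\<in>F. (cmod (kform ?v (f i)))\<^sup>2) \<le> frame_energy I f ?v"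
      unfolding frame_energy_def using assms
      by (intro finite_sum_le_infsum summable_coefficients) auto
    also have "\<dots> \<le> \<beta> * (norm ?u)\<^sup>2" using frame_energy_le [of ?v] by simp
    finally have "sqrt (\<Sum>i\<in>F. (cmod (kform ?v (f i)))\<^sup>2) \<le> sqrt (\<beta> * (norm ?u)\<^sup>2)"
      by (rule real_sqrt_le_mono)
    then show "L2_set (\<lambda>i. cmod (kform ?v (f i))) F \<le> sqrt \<beta> * norm ?u"
      by (simp add: L2_set_def real_sqrt_mult)
  qed (simp add: X_def)
  finally have "norm ?u * norm ?u \<le> (X * sqrt \<beta>) * norm ?u"
    by (simp add: power2_eq_square mult_ac)
  then have "norm ?u \<le> X * sqrt \<beta>"
    using bessel_pos by (cases "norm ?u = 0") (auto simp: X_def)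
  then have "(norm ?u)\<^sup>2 \<le> (X * sqrt \<beta>)\<^sup>2" by (rule power_mono) simp
  then show ?thesis
    using bessel_pos by (simp add: X_def power_mult_distrib L2_set_def sum_nonneg mult.commute)
qed

lemma summable_synthesis:
  assumes x: "x \<in> ell2 I"
  shows "(\<lambda>i. x i *\<^sub>C f i) summable_on I"
proof -
  let ?s = "sum (\<lambda>i. x i *\<^sub>C f i)" and ?a = "\<lambda>i. (cmod (x i))\<^sup>2"
  have summ: "?a summable_on I" using x by (simp add: ell2_def)
  have "\<exists>P. eventually P (finite_subsets_at_top I) \<and>
      (\<forall>F F'. P F \<and> P F' \<longrightarrow> dist (?s F) (?s F') < e)" if "e > 0" for e
  proof -
    define d where "d = (e / 2)\<^sup>2 / (2 * \<beta>)"
    have d: "d > 0" "\<beta> * d < (e / 2)\<^sup>2" using \<open>e > 0\<close> bessel_pos by (simp_all add: d_def)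
    obtain F0 where F0: "finite F0" "F0 \<subseteq> I" "dist (sum ?a F0) (infsum ?a I) \<le> d"
      using infsum_finite_approximation [OF summ d(1)] by blast
    have close: "dist (?s F) (?s F0) < e / 2" if F: "finite F" "F \<subseteq> I" "F0 \<subseteq> F" for F
    proof (rule power2_less_imp_less)
      have "(dist (?s F) (?s F0))\<^sup>2 = (norm (?s (F - F0)))\<^sup>2"
        using F by (simp add: dist_norm sum_diff)
      also have "\<dots> \<le> \<beta> * sum ?a (F - F0)"
        using F by (intro norm_finite_synthesis_le) auto
      also have "sum ?a (F - F0) = sum ?a F - sum ?a F0" using F by (simp add: sum_diff)
      also have "\<beta> * (sum ?a F - sum ?a F0) \<le> \<beta> * d"
        using F0(3) finite_sum_le_infsum [OF summ F(1,2)] bessel_pos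
        by (intro mult_left_mono) (auto simp: dist_real_def)
      finally show "(dist (?s F) (?s F0))\<^sup>2 < (e / 2)\<^sup>2" using d(2) by simp
    qed (use \<open>e > 0\<close> in simp)
    have "dist (?s F) (?s F') < e"
      if "finite F \<and> F \<subseteq> I \<and> F0 \<subseteq> F" "finite F' \<and> F' \<subseteq> I \<and> F0 \<subseteq> F'" for F F'
      using close [of F] close [of F'] that dist_triangle2 [of "?s F" "?s F'" "?s F0"] by simp
    moreover have "\<forall>\<^sub>F F in finite_subsets_at_top I. finite F \<and> F \<subseteq> I \<and> F0 \<subseteq> F"
      using F0 by (auto simp: eventually_finite_subsets_at_top)
    ultimately show ?thesis
      by (intro exI [of _ "\<lambda>F. finite F \<and> F \<subseteq> I \<and> F0 \<subseteq> F"]) blast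
  qed
  then have "cauchy_filter (filtermap ?s (finite_subsets_at_top I))"
    by (simp add: cauchy_filter_metric_filtermap)
  then obtain l where "(?s \<longlongrightarrow> l) (finite_subsets_at_top I)"
    using complete_uniform [where S = "UNIV :: 'a set"] complete_UNIV
    by (force simp: filterlim_def)
  then show ?thesis by (auto simp: summable_on_def has_sum_def)
qed

lemma norm_synthesis_le:
  assumes x: "x \<in> ell2 I"
  shows "(norm (synthesis I f x))\<^sup>2 \<le> \<beta> * (\<Sum>\<^sub>\<infinity>i\<in>I. (cmod (x i))\<^sup>2)"
proof (rule tendsto_upperbound)
  show "((\<lambda>F. (norm (\<Sum>i\<in>F. x i *\<^sub>C f i))\<^sup>2) \<longlongrightarrow> (norm (synthesis I f x))\<^sup>2) (finite_subsets_at_top I)"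
    unfolding synthesis_def
    by (intro tendsto_intros infsum_tendsto summable_synthesis x)
  show "\<forall>\<^sub>F F in finite_subsets_at_top I.
      (norm (\<Sum>i\<in>F. x i *\<^sub>C f i))\<^sup>2 \<le> \<beta> * (\<Sum>\<^sub>\<infinity>i\<in>I. (cmod (x i))\<^sup>2)"
  proof (rule eventually_finite_subsets_at_top_weakI)
    fix F assume F: "finite F" "F \<subseteq> I"
    have "(norm (\<Sum>i\<in>F. x i *\<^sub>C f i))\<^sup>2 \<le> \<beta> * (\<Sum>i\<in>F. (cmod (x i))\<^sup>2)"
      by (rule norm_finite_synthesis_le [OF F])
    also have "\<dots> \<le> \<beta> * (\<Sum>\<^sub>\<infinity>i\<in>I. (cmod (x i))\<^sup>2)"
      using x F bessel_pos by (intro mult_left_mono finite_sum_le_infsum) (auto simp: ell2_def)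
    finally show "(norm (\<Sum>i\<in>F. x i *\<^sub>C f i))\<^sup>2 \<le> \<beta> * (\<Sum>\<^sub>\<infinity>i\<in>I. (cmod (x i))\<^sup>2)" .
  qed
qed simp

lemma summable_kform_synthesis:
  "x \<in> ell2 I \<Longrightarrow> (\<lambda>i. x i * kform (f i) y) summable_on I"
  using summable_on_bounded_linear [OF bounded_linear_kform_left [of y] summable_synthesis]
  by (simp add: kform_scaleC_left)

lemma kform_infsum_synthesis:
  assumes "x \<in> ell2 I" "K \<subseteq> I"
  shows "kform (\<Sum>\<^sub>\<infinity>i\<in>K. x i *\<^sub>C f i) y = (\<Sum>\<^sub>\<infinity>i\<in>K. x i * kform (f i) y)"
  using has_sum_bounded_linear [OF bounded_linear_kform_left [of y]
      has_sum_infsum [OF summable_on_subset_banach [OF summable_synthesis [OF assms(1)] assms(2)]]]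
  by (simp add: kform_scaleC_left infsumI)

lemma synthesis_split: "x \<in> ell2 I \<Longrightarrow> synthesis I f x = synthesis_plus I f x + synthesis_minus I f x"
  unfolding synthesis_plus_eq synthesis_minus_eq synthesis_def
  by (rule infsum_index_split [OF summable_synthesis])

lemma signed_coefficients_ell2: "signed_coefficients I f y \<in> ell2 I"
proof -
  have "(\<lambda>i. (cmod (signed_coefficients I f y i))\<^sup>2) summable_on I"
    using summable_coefficients [of y]
    by (subst summable_on_cong [where g = "\<lambda>i. (cmod (kform y (f i)))\<^sup>2"])
      (simp_all add: norm_signed_coefficients)
  then show ?thesis
    by (auto simp: ell2_def signed_coefficients_def index_plus_def index_minus_def)
qed

lemma kform_synthesis:
  assumes "x \<in> ell2 I"
  shows "kform (synthesis I f x) y = ell2_form I f x (signed_coefficients I f y)"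
  using infsum_index_split [OF summable_kform_synthesis [OF assms, of y], of f]
    kform_infsum_synthesis [OF assms order_refl, of y]
  by (simp add: ell2_form_def infsum_signed_coefficients synthesis_def)

text \<open>The unit sequences show that the adjoint is unique.\<close>

lemma krein_adjoint_synthesis:
  "krein_adjoint (ell2 I) (ell2_form I f) (synthesis I f) y = signed_coefficients I f y"
  unfolding krein_adjoint_def
proof (rule the_equality)
  show "signed_coefficients I f y \<in> ell2 I \<and>
      (\<forall>x\<in>ell2 I. kform (synthesis I f x) y = ell2_form I f x (signed_coefficients I f y))"
    by (simp add: signed_coefficients_ell2 kform_synthesis)
next
  fix w assume w: "w \<in> ell2 I \<and> (\<forall>x\<in>ell2 I. kform (synthesis I f x) y = ell2_form I f x w)"
  show "w = signed_coefficients I f y"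
  proof
    fix i
    show "w i = signed_coefficients I f y i"
    proof (cases "i \<in> I")
      case True
      let ?e = "\<lambda>j. if j = i then 1 else 0 :: complex"
      have "kform (f i) y = ell2_form I f ?e w"
        using w ell2_unit [OF True] by (metis synthesis_unit [OF True])
      also have "\<dots> = (if i \<in> index_plus I f then cnj (w i) else 0)
          - (if i \<in> index_minus I f then cnj (w i) else 0)"
        unfolding ell2_form_def by (subst (1 2) infsum_unit [where i = i]) auto
      finally have "kform y (f i) = cnj ((if i \<in> index_plus I f then cnj (w i) else 0)
          - (if i \<in> index_minus I f then cnj (w i) else 0))"
        by (simp add: kform_hermitian [of y])
      then show ?thesis
        using True index_Un [of I f] index_Int [of I f]
        by (auto simp: signed_coefficients_def)
    next
      case False
      then show ?thesis using w signed_coefficients_ell2 [of y] by (simp add: ell2_def)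
    qed
  qed
qed

lemma J_frame_operator_eq: "J_frame_operator I f y = synthesis I f (signed_coefficients I f y)"
  by (simp add: J_frame_operator_def krein_adjoint_synthesis)

lemma J_frame_operator_selfadjoint:
  "kform (J_frame_operator I f x) y = kform x (J_frame_operator I f y)"
proof -
  have "kform (J_frame_operator I f u) v =
      ell2_form I f (signed_coefficients I f u) (signed_coefficients I f v)" for u v
    by (simp add: J_frame_operator_eq kform_synthesis signed_coefficients_ell2)
  then show ?thesis by (metis ell2_form_hermitian kform_hermitian)
qed

lemma norm_J_frame_operator_le: "(norm (J_frame_operator I f y))\<^sup>2 \<le> \<beta> * frame_energy I f y"
proof -
  have "(\<Sum>\<^sub>\<infinity>i\<in>I. (cmod (signed_coefficients I f y i))\<^sup>2) = frame_energy I f y"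
    unfolding frame_energy_def by (rule infsum_cong) (simp add: norm_signed_coefficients)
  then show ?thesis
    using norm_synthesis_le [OF signed_coefficients_ell2 [of y]] by (simp add: J_frame_operator_eq)
qed

lemma frame_energy_split:
  "frame_energy I f y = frame_energy (index_plus I f) f y + frame_energy (index_minus I f) f y"
  unfolding frame_energy_def by (rule infsum_index_split [OF summable_coefficients])

lemma kform_synthesis_plus_signed:
  "kform (synthesis_plus I f (signed_coefficients I f y)) y = of_real (frame_energy (index_plus I f) f y)"
proof -
  have "kform (synthesis_plus I f (signed_coefficients I f y)) y =
      (\<Sum>\<^sub>\<infinity>i\<in>index_plus I f. signed_coefficients I f y i * kform (f i) y)"
    unfolding synthesis_plus_eq
    by (rule kform_infsum_synthesis [OF signed_coefficients_ell2 index_plus_subset])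
  also have "\<dots> = (\<Sum>\<^sub>\<infinity>i\<in>index_plus I f. of_real ((cmod (kform y (f i)))\<^sup>2))"
    by (rule infsum_cong)
      (simp add: signed_coefficients_def complex_norm_square flip: kform_hermitian del: of_real_power)
  also have "\<dots> = of_real (frame_energy (index_plus I f) f y)"
    unfolding frame_energy_def
    by (intro infsumI has_sum_bounded_linear [OF bounded_linear_of_real] has_sum_infsum
        summable_on_subset_banach [OF summable_coefficients index_plus_subset])
  finally show ?thesis .
qed

lemma kform_synthesis_minus_signed:
  "kform (synthesis_minus I f (signed_coefficients I f y)) y = - of_real (frame_energy (index_minus I f) f y)"
proof -
  have "kform (synthesis_minus I f (signed_coefficients I f y)) y =
      (\<Sum>\<^sub>\<infinity>i\<in>index_minus I f. signed_coefficients I f y i * kform (f i) y)"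
    unfolding synthesis_minus_eq
    by (rule kform_infsum_synthesis [OF signed_coefficients_ell2 index_minus_subset])
  also have "\<dots> = (\<Sum>\<^sub>\<infinity>i\<in>index_minus I f. - of_real ((cmod (kform y (f i)))\<^sup>2))"
    using index_Int [of I f]
    by (intro infsum_cong)
      (auto simp: signed_coefficients_def complex_norm_square simp flip: kform_hermitian simp del: of_real_power)
  also have "\<dots> = - (\<Sum>\<^sub>\<infinity>i\<in>index_minus I f. of_real ((cmod (kform y (f i)))\<^sup>2))"
    by (rule infsum_uminus)
  also have "(\<Sum>\<^sub>\<infinity>i\<in>index_minus I f. complex_of_real ((cmod (kform y (f i)))\<^sup>2)) =
      of_real (frame_energy (index_minus I f) f y)"
    unfolding frame_energy_def
    by (intro infsumI has_sum_bounded_linear [OF bounded_linear_of_real] has_sum_infsum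
        summable_on_subset_banach [OF summable_coefficients index_minus_subset])
  finally show ?thesis .
qed

end

section \<open>The associated Parseval J-frame\<close>

lemma uniformly_definite_Int:
  assumes "uniformly_J_positive M" "uniformly_J_negative N" "x \<in> M" "x \<in> N"
  shows "x = 0"
proof -
  obtain a b where "a > 0" "a * (norm x)\<^sup>2 \<le> Re (kform x x)"
      "b > 0" "b * (norm x)\<^sup>2 \<le> - Re (kform x x)"
    using assms by (auto simp: uniformly_J_positive_def uniformly_J_negative_def)
  then have "(a + b) * (norm x)\<^sup>2 \<le> 0" "a + b > 0" by (simp_all add: distrib_right)
  then show ?thesis by (simp add: mult_le_0_iff)
qed

lemma frame_of_lower_bound:
  assumes "bessel_family I h" "c > 0" "\<And>y. c * (norm y)\<^sup>2 \<le> frame_energy I h y"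
  shows "frame I h"
  unfolding frame_def hinner_eq_kform_left
  using assms(1,2) assms(3) [of "fund_sym y" for y] by (auto simp: frame_energy_def)

context
  fixes I :: "'i set" and f :: "'i \<Rightarrow> 'a::krein_space" and \<beta> :: real
  assumes bessel: "bessel_bound I f \<beta>" and J_frame: "J_frame I f"
begin

private abbreviation (input) S where "S \<equiv> J_frame_operator I f"

private abbreviation (input) M_plus where "M_plus \<equiv> synthesis_plus I f ` ell2 I"

private abbreviation (input) M_minus where "M_minus \<equiv> synthesis_minus I f ` ell2 I"

lemma uniformly_J_positive_M_plus: "uniformly_J_positive M_plus"
  and uniformly_J_negative_M_minus: "uniformly_J_negative M_minus"
  using J_frame
  by (simp_all add: J_frame_def maximal_uniformly_J_positive_def maximal_uniformly_J_negative_def)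

lemma
  shows M_plus_subspace: "cvec.subspace M_plus" and M_minus_subspace: "cvec.subspace M_minus"
  using uniformly_J_positive_M_plus uniformly_J_negative_M_minus
  by (simp_all add: uniformly_J_positive_def uniformly_J_negative_def)

lemma J_frame_operator_split:
  "S u = synthesis_plus I f (signed_coefficients I f u) + synthesis_minus I f (signed_coefficients I f u)"
  by (simp add: J_frame_operator_eq [OF bessel] synthesis_split [OF bessel] signed_coefficients_ell2 [OF bessel])

text \<open>
  If \<open>S u\<close> lies in \<open>M_plus\<close>, the component of \<open>S u\<close> in \<open>M_minus\<close> lies in both subspaces and so
  vanishes. Pairing it with \<open>u\<close> shows that \<open>u\<close> is orthogonal to every negative frame vector, and
  \<open>[S u, u]\<close> is the full sum of the \<open>\<bar>[u, f\<^sub>i]\<bar>\<^sup>2\<close>. So \<open>S\<^sup>-\<^sup>1\<close> is uniformly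
  positive on \<open>M_plus\<close>; this is the estimate that makes the transformed subspace definite.
\<close>

lemma kform_J_frame_operator_plus:
  assumes "S u \<in> M_plus"
  shows "kform (S u) u = of_real (frame_energy I f u)"
proof -
  let ?w = "signed_coefficients I f u"
  have "synthesis_minus I f ?w = S u - synthesis_plus I f ?w"
    by (simp add: J_frame_operator_split)
  also have "\<dots> \<in> M_plus"
    using assms signed_coefficients_ell2 [OF bessel, of u]
    by (intro cvec.subspace_diff [OF M_plus_subspace]) auto
  finally have "synthesis_minus I f ?w = 0"
    using uniformly_definite_Int [OF uniformly_J_positive_M_plus uniformly_J_negative_M_minus]
      signed_coefficients_ell2 [OF bessel, of u] by blast
  moreover from this have "frame_energy (index_minus I f) f u = 0"
    using kform_synthesis_minus_signed [OF bessel, of u] by simp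
  ultimately show ?thesis
    by (simp add: J_frame_operator_split kform_synthesis_plus_signed [OF bessel]
        frame_energy_split [OF bessel])
qed

lemma kform_J_frame_operator_minus:
  assumes "S u \<in> M_minus"
  shows "kform (S u) u = - of_real (frame_energy I f u)"
proof -
  let ?w = "signed_coefficients I f u"
  have "synthesis_plus I f ?w = S u - synthesis_minus I f ?w"
    by (simp add: J_frame_operator_split)
  also have "\<dots> \<in> M_minus"
    using assms signed_coefficients_ell2 [OF bessel, of u]
    by (intro cvec.subspace_diff [OF M_minus_subspace]) auto
  finally have "synthesis_plus I f ?w = 0"
    using uniformly_definite_Int [OF uniformly_J_positive_M_plus uniformly_J_negative_M_minus]
      signed_coefficients_ell2 [OF bessel, of u] by blast
  moreover from this have "frame_energy (index_plus I f) f u = 0"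
    using kform_synthesis_plus_signed [OF bessel, of u] by simp
  ultimately show ?thesis
    by (simp add: J_frame_operator_split kform_synthesis_minus_signed [OF bessel]
        frame_energy_split [OF bessel])
qed

text \<open>
  From here on \<open>V\<close> is a selfadjoint invertible operator with \<open>V\<^sup>2 = S\<^sup>-\<^sup>1\<close>, and \<open>g\<^sub>i = V f\<^sub>i\<close>.
\<close>

context
  fixes V :: "'a \<Rightarrow> 'a"
  assumes V: "invertible_op V" and sa: "\<And>x y. kform (V x) y = kform x (V y)"
    and SVV: "\<And>x. S (V (V x)) = x" and VSV: "\<And>x. V (S (V x)) = x"
begin

private abbreviation (input) g where "g \<equiv> \<lambda>i. V (f i)"

lemma V_bounded_clinear: "bounded_clinear V"
  using V by (rule invertible_op_imp_bounded_clinear)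

lemma frame_energy_transformed: "frame_energy I g h = frame_energy I f (V h)"
  by (simp add: frame_energy_def sa)

text \<open>
  \<open>[V m, V m] = [S\<^sup>-\<^sup>1 m, m]\<close>, so the computation of \<open>[S u, u]\<close> applies with \<open>u = S\<^sup>-\<^sup>1 m\<close>;
  the Bessel bound for \<open>S u = m\<close> turns it into a lower estimate.
\<close>

lemma kform_V_plus:
  assumes "m \<in> M_plus"
  shows "(norm m)\<^sup>2 \<le> \<beta> * Re (kform (V m) (V m))"
proof -
  have "kform m (V (V m)) = of_real (frame_energy I f (V (V m)))"
    using kform_J_frame_operator_plus [of "V (V m)"] assms by (simp add: SVV)
  then have "Re (kform (V m) (V m)) = frame_energy I f (V (V m))" by (simp add: sa)
  then show ?thesis
    using norm_J_frame_operator_le [OF bessel, of "V (V m)"] by (simp add: SVV)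
qed

lemma kform_V_minus:
  assumes "m \<in> M_minus"
  shows "(norm m)\<^sup>2 \<le> - (\<beta> * Re (kform (V m) (V m)))"
proof -
  have "kform m (V (V m)) = - of_real (frame_energy I f (V (V m)))"
    using kform_J_frame_operator_minus [of "V (V m)"] assms by (simp add: SVV)
  then have "Re (kform (V m) (V m)) = - frame_energy I f (V (V m))" by (simp add: sa)
  then show ?thesis
    using norm_J_frame_operator_le [OF bessel, of "V (V m)"] by (simp add: SVV)
qed

text \<open>
  For \<open>i\<close> in \<open>index_minus\<close> the strict inequality survives because \<open>f\<^sub>i \<noteq> 0\<close>, being a vector with
  \<open>[f\<^sub>i, f\<^sub>i] < 0\<close>.
\<close>

lemma index_plus_transformed: "index_plus I g = index_plus I f"
  and index_minus_transformed: "index_minus I g = index_minus I f"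
proof -
  have \<beta>: "\<beta> > 0" using bessel by (rule bessel_pos)
  have plus: "Re (kform (g i) (g i)) \<ge> 0" if "i \<in> index_plus I f" for i
    using kform_V_plus [OF vector_in_synthesis_plus [OF that]] \<beta> zero_le_power2 [of "norm (f i)"]
    by (smt (verit) mult_pos_neg)
  have minus: "Re (kform (g i) (g i)) < 0" if "i \<in> index_minus I f" for i
  proof -
    have "f i \<noteq> 0" using that by (auto simp: index_minus_def)
    then have "0 < (norm (f i))\<^sup>2" by simp
    also have "\<dots> \<le> - (\<beta> * Re (kform (g i) (g i)))"
      by (rule kform_V_minus [OF vector_in_synthesis_minus [OF that]])
    finally show ?thesis using \<beta> by (simp add: mult_less_0_iff)
  qed
  show "index_plus I g = index_plus I f" "index_minus I g = index_minus I f"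
    using plus minus by (fastforce simp: index_plus_def index_minus_def)+
qed

lemma bessel_bound_transformed: "\<exists>\<beta>'. bessel_bound I g \<beta>'"
proof -
  obtain K where K: "K > 0" "\<And>x. norm (V x) \<le> K * norm x"
    using bounded_clinear_bound [OF V_bounded_clinear] by blast
  have "frame_energy I g h \<le> \<beta> * K\<^sup>2 * (norm h)\<^sup>2" for h
  proof -
    have "frame_energy I g h \<le> \<beta> * (norm (V h))\<^sup>2"
      unfolding frame_energy_transformed by (rule frame_energy_le [OF bessel])
    also have "\<dots> \<le> \<beta> * (K * norm h)\<^sup>2"
      using K bessel_pos [OF bessel] by (intro mult_left_mono power_mono) auto
    finally show ?thesis by (simp add: power_mult_distrib)
  qed
  then have "bessel_bound I g (\<beta> * K\<^sup>2)"
    using bessel_pos [OF bessel] K(1) summable_coefficients [OF bessel]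
    by (simp add: bessel_bound_def frame_energy_def flip: sa)
  then show ?thesis by blast
qed

lemma infsum_transformed:
  assumes "x \<in> ell2 I" "K \<subseteq> I"
  shows "(\<Sum>\<^sub>\<infinity>i\<in>K. x i *\<^sub>C g i) = V (\<Sum>\<^sub>\<infinity>i\<in>K. x i *\<^sub>C f i)"
  using has_sum_bounded_linear [OF bounded_clinear_imp_bounded_linear [OF V_bounded_clinear]
      has_sum_infsum [OF summable_on_subset_banach [OF summable_synthesis [OF bessel assms(1)] assms(2)]]]
  by (simp add: bounded_clinear_scaleC [OF V_bounded_clinear] infsumI)

lemma synthesis_plus_transformed: "synthesis_plus I g ` ell2 I = V ` M_plus"
  unfolding image_image
  by (intro image_cong refl)
    (simp add: synthesis_plus_eq index_plus_transformed infsum_transformed index_plus_subset)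

lemma synthesis_minus_transformed: "synthesis_minus I g ` ell2 I = V ` M_minus"
  unfolding image_image
  by (intro image_cong refl)
    (simp add: synthesis_minus_eq index_minus_transformed infsum_transformed index_minus_subset)

lemma norm_V_image_bound:
  obtains c where "c > 0" "\<And>m. c * (norm (V m))\<^sup>2 \<le> (norm m)\<^sup>2 / \<beta>"
proof -
  have \<beta>: "\<beta> > 0" using bessel by (rule bessel_pos)
  obtain K where K: "K > 0" "\<And>x. norm (V x) \<le> K * norm x"
    using bounded_clinear_bound [OF V_bounded_clinear] by blast
  have "1 / (\<beta> * K\<^sup>2) * (norm (V m))\<^sup>2 \<le> (norm m)\<^sup>2 / \<beta>" for m
    using power_mono [OF K(2) [of m], of 2] K(1) \<beta>
    by (simp add: power_mult_distrib divide_simps mult_ac)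
  then show ?thesis using K(1) \<beta> that [of "1 / (\<beta> * K\<^sup>2)"] by simp
qed

lemma uniformly_J_positive_transformed: "uniformly_J_positive (V ` M_plus)"
proof -
  obtain c where c: "c > 0" "\<And>m. c * (norm (V m))\<^sup>2 \<le> (norm m)\<^sup>2 / \<beta>"
    using norm_V_image_bound by blast
  have "c * (norm x)\<^sup>2 \<le> Re (kform x x)" if "x \<in> V ` M_plus" for x
  proof -
    obtain m where m: "m \<in> M_plus" "x = V m" using \<open>x \<in> V ` M_plus\<close> by (rule imageE)
    have "(norm m)\<^sup>2 / \<beta> \<le> Re (kform x x)"
      using kform_V_plus [OF m(1)] bessel_pos [OF bessel] by (simp add: m(2) divide_simps mult.commute)
    with c(2) [of m] show ?thesis by (simp add: m(2))
  qed
  with c(1) show ?thesis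
    unfolding uniformly_J_positive_def using bounded_clinear_subspace_image [OF V_bounded_clinear M_plus_subspace] by blast
qed

lemma uniformly_J_negative_transformed: "uniformly_J_negative (V ` M_minus)"
proof -
  obtain c where c: "c > 0" "\<And>m. c * (norm (V m))\<^sup>2 \<le> (norm m)\<^sup>2 / \<beta>"
    using norm_V_image_bound by blast
  have "c * (norm x)\<^sup>2 \<le> - Re (kform x x)" if "x \<in> V ` M_minus" for x
  proof -
    obtain m where m: "m \<in> M_minus" "x = V m" using \<open>x \<in> V ` M_minus\<close> by (rule imageE)
    have "(norm m)\<^sup>2 / \<beta> \<le> - Re (kform x x)"
      using kform_V_minus [OF m(1)] bessel_pos [OF bessel] by (simp add: m(2) divide_simps mult.commute)
    with c(2) [of m] show ?thesis by (simp add: m(2))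
  qed
  with c(1) show ?thesis
    unfolding uniformly_J_negative_def using bounded_clinear_subspace_image [OF V_bounded_clinear M_minus_subspace] by blast
qed

text \<open>The splitting of \<open>S (V x)\<close> into its two components, transported by \<open>V\<close>.\<close>

lemma transformed_span:
  obtains p q where "p \<in> V ` M_plus" "q \<in> V ` M_minus" "x = p + q"
proof -
  let ?w = "signed_coefficients I f (V x)"
  have "x = V (S (V x))" by (simp add: VSV)
  also have "\<dots> = V (synthesis_plus I f ?w) + V (synthesis_minus I f ?w)"
    by (simp add: J_frame_operator_split bounded_clinear_add [OF V_bounded_clinear])
  finally show ?thesis
    using that signed_coefficients_ell2 [OF bessel, of "V x"] by blast
qed

text \<open>
  Two complementary subspaces, one uniformly positive and one uniformly negative, are both maximal:
  a strictly larger positive subspace would meet the negative one.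
\<close>

lemma J_frame_transformed: "J_frame I g"
  unfolding J_frame_def synthesis_plus_transformed synthesis_minus_transformed
    maximal_uniformly_J_positive_def maximal_uniformly_J_negative_def
proof (intro conjI allI impI uniformly_J_positive_transformed uniformly_J_negative_transformed)
  show "bessel_family I g"
    using bessel_bound_transformed by (simp add: bessel_family_iff)
next
  fix N assume N: "uniformly_J_positive N \<and> V ` M_plus \<subseteq> N"
  have "x \<in> V ` M_plus" if "x \<in> N" for x
  proof -
    obtain p q where pq: "p \<in> V ` M_plus" "q \<in> V ` M_minus" "x = p + q"
      by (rule transformed_span)
    have "x - p \<in> N"
      using N pq(1) that by (intro cvec.subspace_diff) (auto simp: uniformly_J_positive_def)
    then have "q = 0"
      using N uniformly_definite_Int [OF _ uniformly_J_negative_transformed _ pq(2), of N] pq(3) by simp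
    then show ?thesis using pq by simp
  qed
  with N show "N = V ` M_plus" by blast
next
  fix N assume N: "uniformly_J_negative N \<and> V ` M_minus \<subseteq> N"
  have "x \<in> V ` M_minus" if "x \<in> N" for x
  proof -
    obtain p q where pq: "p \<in> V ` M_plus" "q \<in> V ` M_minus" "x = p + q"
      by (rule transformed_span)
    have "x - q \<in> N"
      using N pq(2) that by (intro cvec.subspace_diff) (auto simp: uniformly_J_negative_def)
    then have "p = 0"
      using N uniformly_definite_Int [OF uniformly_J_positive_transformed _ pq(1), of N] pq(3) by simp
    then show ?thesis using pq by simp
  qed
  with N show "N = V ` M_minus" by blast
qed

lemma J_frame_operator_transformed: "J_frame_operator I g y = y"
proof -
  obtain \<beta>' where b: "bessel_bound I g \<beta>'" using bessel_bound_transformed by blast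
  have "signed_coefficients I g y = signed_coefficients I f (V y)"
    by (rule ext) (simp add: signed_coefficients_def index_plus_transformed index_minus_transformed sa)
  then have "J_frame_operator I g y = V (S (V y))"
    using infsum_transformed [OF signed_coefficients_ell2 [OF bessel] order_refl]
    by (simp add: J_frame_operator_eq [OF b] J_frame_operator_eq [OF bessel] synthesis_def)
  then show ?thesis by (simp add: VSV)
qed

text \<open>
  The lower frame bound of \<open>f\<close> comes from \<open>\<parallel>S y\<parallel>\<^sup>2 \<le> \<beta> \<Sum> \<bar>[y, f\<^sub>i]\<bar>\<^sup>2\<close>, because \<open>S\<close> is bounded
  below; that of \<open>g\<close> follows because \<open>V\<close> is bounded below as well.
\<close>

lemma similar_frames_transformed: "similar_frames I f g"
proof -
  have \<beta>: "\<beta> > 0" using bessel by (rule bessel_pos)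
  have inv: "invertible_op (\<lambda>x. V (V x))" using invertible_op_comp [OF V V] .
  obtain K where K: "K > 0" "\<And>x. norm (V (V x)) \<le> K * norm x"
    using bounded_clinear_bound [OF invertible_op_imp_bounded_clinear [OF inv]] by blast
  have VVS: "V (V (S y)) = y" for y
    using invertible_op_obtain [OF inv] SVV by metis
  have low: "1 / (\<beta> * K\<^sup>2) * (norm y)\<^sup>2 \<le> frame_energy I f y" for y
  proof -
    have "(norm y)\<^sup>2 \<le> (K * norm (S y))\<^sup>2"
      using K(2) [of "S y"] by (simp add: VVS power_mono)
    also have "\<dots> \<le> K\<^sup>2 * (\<beta> * frame_energy I f y)"
      using norm_J_frame_operator_le [OF bessel, of y]
      by (simp add: power_mult_distrib mult_left_mono)
    finally show ?thesis using \<beta> K(1) by (simp add: divide_simps mult_ac)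
  qed
  have "frame I f"
    using \<beta> K(1) bessel by (intro frame_of_lower_bound [OF _ _ low]) (auto simp: bessel_family_iff)
  moreover obtain c where c: "c > 0" "\<And>x. c * norm x \<le> norm (V x)"
    using invertible_op_bounded_below [OF V] by blast
  have "1 / (\<beta> * K\<^sup>2) * c\<^sup>2 * (norm y)\<^sup>2 \<le> frame_energy I g y" for y
  proof -
    have "1 / (\<beta> * K\<^sup>2) * (c * norm y)\<^sup>2 \<le> 1 / (\<beta> * K\<^sup>2) * (norm (V y))\<^sup>2"
      using c \<beta> by (intro mult_left_mono power_mono) auto
    also have "\<dots> \<le> frame_energy I g y"
      unfolding frame_energy_transformed by (rule low)
    finally show ?thesis by (simp add: power_mult_distrib)
  qed
  then have "frame I g"
    using \<beta> K(1) c(1) bessel_bound_transformed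
    by (intro frame_of_lower_bound [where c = "1 / (\<beta> * K\<^sup>2) * c\<^sup>2"]) (auto simp: bessel_family_iff)
  ultimately show ?thesis
    using V by (auto simp: similar_frames_def)
qed

end

end

theorem theorem5p7:
  fixes I :: "'i set"
    and f :: "'i \<Rightarrow> 'a::krein_space"
    and \<Gamma> :: "real \<Rightarrow> complex"
    and S S_half :: "'a \<Rightarrow> 'a"
  assumes "J_frame I f"
    and "S = J_frame_operator I f"
    and "valid_path \<Gamma>" and "simple_path \<Gamma>" and "pathfinish \<Gamma> = pathstart \<Gamma>"
    and "\<forall>z\<in>inside (path_image \<Gamma>). winding_number \<Gamma> z = 1"
    and "path_image \<Gamma> \<subseteq> {z. Re z > 0}"
    and "op_spectrum S \<subseteq> inside (path_image \<Gamma>)"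
    and "S_half = contour_sqrt \<Gamma> S"
  shows "parseval_J_frame I (\<lambda>i. inv S_half (f i))
       \<and> similar_frames I f (\<lambda>i. inv S_half (f i))"
proof -
  obtain \<beta> where bessel: "bessel_bound I f \<beta>"
    using assms(1) by (auto simp: J_frame_def bessel_family_iff)
  have sa: "kform (S x) y = kform x (S y)" for x y
    unfolding assms(2) by (rule J_frame_operator_selfadjoint [OF bessel])
  have "inside (path_image \<Gamma>) \<subseteq> {z. Re z > 0}"
    using outside_subset_convex [OF convex_halfspace_Re_gt assms(7)] inside_Int_outside by blast
  then have "0 \<notin> op_spectrum S" using assms(8) by auto
  \<comment> \<open>Boundedness of \<open>S\<close> is read off from \<open>0\<close> lying outside its spectrum.\<close>
  then have "invertible_op (\<lambda>x. - S x)" by (simp add: op_spectrum_def)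
  moreover have "invertible_op (uminus :: 'a \<Rightarrow> 'a)"
    by (rule invertible_opI [where B = uminus])
      (auto intro!: bounded_clinearI [where K = 1] simp: cvec.scale_minus_right)
  ultimately have "invertible_op (\<lambda>x. - (- S x))"
    by (rule invertible_op_comp [rotated])
  then have invS: "invertible_op S" by simp
  have S: "bounded_clinear S" using invS by (rule invertible_op_imp_bounded_clinear)
  interpret sqrt_contour S \<Gamma>
  proof
    have "op_spectrum S \<inter> path_image \<Gamma> = {}"
      using assms(8) inside_no_overlap by blast
    then show "path_image \<Gamma> \<subseteq> {z. Re z > 0} - op_spectrum S" using assms(7) by blast
    show "bounded (op_spectrum S)"
      using assms(8) bounded_inside [OF compact_imp_bounded [OF compact_valid_path_image [OF assms(3)]]]
      by (rule bounded_subset [rotated])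
  qed (use S sa assms in auto)
  have Q: "bounded_clinear S_half"
    unfolding assms(9) by (rule bounded_clinear_contour_sqrt [OF S \<gamma>(1) im])
  have QQ: "S_half (S_half x) = S x" for x
    unfolding assms(9) by (rule sqrt_square)
  obtain S' where S': "bounded_clinear S'" "\<And>x. S (S' x) = x" "\<And>x. S' (S x) = x"
    using invertible_op_obtain [OF invS] by blast
  have comm: "S_half (S' x) = S' (S_half x)" for x
    by (metis QQ S'(2,3))
  have "invertible_op S_half"
    by (rule invertible_opI [OF Q bounded_clinear_comp [OF S'(1) Q]])
      (simp_all add: QQ S' flip: comm)
  then obtain V where V: "\<And>x. S_half (V x) = x" "\<And>x. V (S_half x) = x" "inv S_half = V" "invertible_op V"
    using invertible_op_obtain invertible_op_inv by metis
  have "kform (V x) y = kform x (V y)" for x y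
    using sqrt_selfadjoint [folded assms(9), of "V x" "V y"] by (simp add: V)
  moreover have "S (V (V x)) = x" "V (S (V x)) = x" for x
    by (simp_all add: V flip: QQ)
  ultimately show ?thesis
    using J_frame_transformed [OF bessel assms(1) V(4), folded assms(2)]
      J_frame_operator_transformed [OF bessel assms(1) V(4), folded assms(2)]
      similar_frames_transformed [OF bessel assms(1) V(4), folded assms(2)]
    by (auto simp: V(3) parseval_J_frame_def fun_eq_iff)
qed

end
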